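(* Let $n\ge2$ be even. Suppose $\pi\in\mathcal U_{1,k}(n)$ with $k\ge1$. Let $\tau$ be the permutation of $[\pm n]$ with cycles $(r,s)(-r,-s)$ whenever $\{r,s\}\in\overline\pi$ and the edges labelled $r,s$ of $G(\pi)$ have opposite orientations, and cycles $(r,-s)(-r,s)$ whenever $\{r,s\}\in\overline\pi$ and the edges labelled $r,s$ of $G(\pi)$ have the same orientation (with the conventions stated in the context for $k=1,2$). Then $\tau\in NC_2^\delta(n,-n)$. Conversely, every element of $NC_2^\delta(n,-n)$ arises in this way from some $\pi\in\mathcal U_{1,k}(n)$ for some $k\ge1$.
   Context: Let $\gamma=(1,2,\dots,n)$. For a partition $\pi$ of $[n]$, $[k]_\pi$ is the block containing $k$. $G(\pi)$ is the directed multigraph with vertex set $\pi$ and, for each $k\in[n]$, an edge labelled $k$, $e_k=([\gamma(k)]_\pi,[k]_\pi)$. $\overline\pi$ is the partition of $[n]$ in which $u\sim v$ iff $e_u,e_v$ have the same set of endpoints (ignoring direction). $\overline G(\pi)$ is the undirected graph with vertex set $\pi$ obtained from $G(\pi)$ by forgetting directions and merging edges whose labels lie in the same block of $\overline\pi$ (loops allowed). Two edges with the same endpoint set have the same orientation if they are equal as ordered pairs and opposite orientations if one is the reversal of the other. A pairing is a partition with all blocks of size 2. **The sets $\mathcal U_{1,k}(n)$.** - $k\ge3$: $\pi\in\mathcal U_{1,k}(n)$ iff $\overline G(\pi)$ is connected with a unique cycle, of length $k$; $\overline\pi$ is a pairing; pairs of edges not on the cycle have opposite orientations; pairs of edges on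 the cycle have the same orientation. - $k=1$: $\mathcal U_{1,1}(n)=\mathcal U_{0,1}(n)$ is the set of $\pi$ such that $\overline G(\pi)$ is a tree with a single loop attached at a vertex, $\overline\pi$ is a pairing, and paired (non-loop) edges have opposite orientations. Convention: the two loop edges are regarded as having the same orientation. - $k=2$: $\mathcal U_{1,2}(n)=\mathcal U_{0,2}(n)$ is the set of $\pi$ such that $\overline G(\pi)$ is a tree, $\overline\pi$ has one block of size 4 and all others of size 2, paired edges have opposite orientations, and the block of size 4 consists of two edges in one orientation and two in the opposite orientation. Convention: here $\overline\pi$ is replaced by the pairing $\overline\pi_3$ obtained by splitting the block of size 4 into its two pairs of edges with the same orientation. **$NC_2^\delta(n,-n)$.** Let $[\pm n]=\{\pm1,\dots,\pm n\}$, $\delta(k)=-k$, and extend $\gamma$ to $[\pm n]$ by acting trivially on negative elements. $S_{NC}^\delta(n,-n)$ is the set of permutations $\tau$ of $[\pm n]$ such that all cycles of $\tau\delta$ have length 2, $\#(\tau)+\#(\tau^{-1}\gamma\delta\gamma^{-1}\delta)=2n$ ($\#$ = number of cycles), and the join of the cycle partitions of $\tau$ and $\gamma\delta\gamma^{-1}\delta$ is the one-block partition of $[\pm n]$. $NC_2^\delta(n,-n)$ is the set of $\tau\in S_{NC}^\delta(n,-n)$ all of whose cycles have length 2. *)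

theory Defs
  imports
    "HOL-Library.Disjoint_Sets"
    "HOL-Combinatorics.Orbits"
    "Graph_Theory.Digraph"
begin

section \<open>Partitions and cycles of permutations\<close>

definition pairing_on :: "'a set \<Rightarrow> 'a set set \<Rightarrow> bool" where
  "pairing_on A P \<longleftrightarrow> partition_on A P \<and> (\<forall>B\<in>P. card B = 2)"

text \<open>The join of two partitions of \<open>A\<close> in the partition lattice: its blocks are the classes of
  the equivalence relation generated by ``lying in a common block of \<open>P\<close> or of \<open>Q\<close>''. The
  transitive closure is reflexive on \<open>A\<close> since \<open>P\<close> covers \<open>A\<close>.\<close>
definition partition_join :: "'a set \<Rightarrow> 'a set set \<Rightarrow> 'a set set \<Rightarrow> 'a set set" where
  "partition_join A P Q = A // ({(x, y). \<exists>B \<in> P \<union> Q. x \<in> B \<and> y \<in> B}\<^sup>+)"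

text \<open>Fixed points count as cycles of length 1.\<close>
definition cycle_partition :: "'a set \<Rightarrow> ('a \<Rightarrow> 'a) \<Rightarrow> 'a set set" where
  "cycle_partition A f = orbit f ` A"


section \<open>Undirected graphs without parallel edges, loops allowed\<close>

text \<open>A graph is given by its vertex set \<open>V\<close> and the set \<open>E\<close> of the endpoint sets of its edges;
  a loop at \<open>v\<close> is the singleton \<open>{v}\<close>.\<close>

definition ugraph_connected :: "'v set \<Rightarrow> 'v set set \<Rightarrow> bool" where
  "ugraph_connected V E \<longleftrightarrow>
     V \<noteq> {} \<and> (\<forall>u\<in>V. \<forall>v\<in>V. (u, v) \<in> {(x, y). x \<in> V \<and> y \<in> V \<and> {x, y} \<in> E}\<^sup>*)"

definition closed_walk_edges :: "'v list \<Rightarrow> 'v set set" where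
  "closed_walk_edges vs = {{vs ! i, vs ! (Suc i mod length vs)} | i. i < length vs}"

text \<open>Cycles as subgraphs, identified with their edge sets. The edges of a cycle are distinct,
  i.e. there are as many of them as vertices: this admits loops (cycles of length 1), and excludes
  walking back and forth along a single edge (there is no cycle of length 2, as there are no
  parallel edges).\<close>
definition ugraph_cycles :: "'v set \<Rightarrow> 'v set set \<Rightarrow> 'v set set set" where
  "ugraph_cycles V E =
     {closed_walk_edges vs | vs. vs \<noteq> [] \<and> distinct vs \<and> set vs \<subseteq> V \<and>
        closed_walk_edges vs \<subseteq> E \<and> card (closed_walk_edges vs) = length vs}"

definition ugraph_tree :: "'v set \<Rightarrow> 'v set set \<Rightarrow> bool" where
  "ugraph_tree V E \<longleftrightarrow> ugraph_connected V E \<and> ugraph_cycles V E = {}"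


section \<open>The graphs of a partition\<close>

text \<open>The set \<open>[n]\<close> is rendered as \<open>{1..int n}\<close>, so that it is a subset of \<open>[\<plusminus>n]\<close>. The
  permutation \<open>\<gamma>\<close> is already extended to act trivially on all other integers.\<close>
definition gamma :: "nat \<Rightarrow> int \<Rightarrow> int" where
  "gamma n k = (if 1 \<le> k \<and> k < int n then k + 1 else if k = int n then 1 else k)"

definition block_of :: "int set set \<Rightarrow> int \<Rightarrow> int set" where
  "block_of \<pi> k = (THE B. B \<in> \<pi> \<and> k \<in> B)"

definition part_digraph :: "nat \<Rightarrow> int set set \<Rightarrow> (int set, int) pre_digraph" where
  "part_digraph n \<pi> =
     \<lparr> verts = \<pi>, arcs = {1..int n},
       tail = (\<lambda>k. block_of \<pi> (gamma n k)), head = (\<lambda>k. block_of \<pi> k) \<rparr>"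

abbreviation edge :: "nat \<Rightarrow> int set set \<Rightarrow> int \<Rightarrow> int set \<times> int set" where
  "edge n \<pi> k \<equiv> arc_to_ends (part_digraph n \<pi>) k"

definition endpoints :: "nat \<Rightarrow> int set set \<Rightarrow> int \<Rightarrow> int set set" where
  "endpoints n \<pi> k = {tail (part_digraph n \<pi>) k, head (part_digraph n \<pi>) k}"

text \<open>The partition \<open>\<pi>\<close>-bar.\<close>
definition edge_partition :: "nat \<Rightarrow> int set set \<Rightarrow> int set set" where
  "edge_partition n \<pi> =
     {1..int n} //
       {(u, v). u \<in> {1..int n} \<and> v \<in> {1..int n} \<and> endpoints n \<pi> u = endpoints n \<pi> v}"

text \<open>The edges of the graph \<open>G\<close>-bar, whose vertex set is \<open>\<pi>\<close>. Edges are merged exactly if they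
  have the same endpoints, so a merged edge is identified with its endpoint set.\<close>
definition merged_edges :: "nat \<Rightarrow> int set set \<Rightarrow> int set set set" where
  "merged_edges n \<pi> = endpoints n \<pi> ` {1..int n}"

definition same_orientation :: "nat \<Rightarrow> int set set \<Rightarrow> int \<Rightarrow> int \<Rightarrow> bool" where
  "same_orientation n \<pi> r s \<longleftrightarrow> edge n \<pi> r = edge n \<pi> s"

text \<open>Two loops at the same vertex are equal as ordered pairs, but also reversals of each other;
  by convention they have the same, and not opposite, orientation.\<close>
definition opposite_orientation :: "nat \<Rightarrow> int set set \<Rightarrow> int \<Rightarrow> int \<Rightarrow> bool" where
  "opposite_orientation n \<pi> r s \<longleftrightarrow>
     edge n \<pi> r = prod.swap (edge n \<pi> s) \<and> edge n \<pi> r \<noteq> edge n \<pi> s"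

definition all_same :: "nat \<Rightarrow> int set set \<Rightarrow> int set \<Rightarrow> bool" where
  "all_same n \<pi> B \<longleftrightarrow> (\<forall>r\<in>B. \<forall>s\<in>B. r \<noteq> s \<longrightarrow> same_orientation n \<pi> r s)"

definition all_opposite :: "nat \<Rightarrow> int set set \<Rightarrow> int set \<Rightarrow> bool" where
  "all_opposite n \<pi> B \<longleftrightarrow> (\<forall>r\<in>B. \<forall>s\<in>B. r \<noteq> s \<longrightarrow> opposite_orientation n \<pi> r s)"


section \<open>The sets \<open>U\<^bsub>1,k\<^esub>(n)\<close>\<close>

definition U01 :: "nat \<Rightarrow> int set set set" where
  "U01 n = {\<pi>. partition_on {1..int n} \<pi> \<and>
     (\<exists>v\<in>\<pi>. {v} \<in> merged_edges n \<pi> \<and> ugraph_tree \<pi> (merged_edges n \<pi> - {{v}}) \<and>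
        pairing_on {1..int n} (edge_partition n \<pi>) \<and>
        (\<forall>B \<in> edge_partition n \<pi>. (\<forall>r\<in>B. endpoints n \<pi> r \<noteq> {v}) \<longrightarrow> all_opposite n \<pi> B))}"

definition U02 :: "nat \<Rightarrow> int set set set" where
  "U02 n = {\<pi>. partition_on {1..int n} \<pi> \<and>
     ugraph_tree \<pi> (merged_edges n \<pi>) \<and>
     (\<exists>B \<in> edge_partition n \<pi>. card B = 4 \<and>
        (\<forall>B' \<in> edge_partition n \<pi> - {B}. card B' = 2 \<and> all_opposite n \<pi> B') \<and>
        (\<exists>A\<subseteq>B. card A = 2 \<and> all_same n \<pi> A \<and> all_same n \<pi> (B - A) \<and>
           (\<forall>r\<in>A. \<forall>s\<in>B - A. opposite_orientation n \<pi> r s)))}"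

definition U1_cyc :: "nat \<Rightarrow> nat \<Rightarrow> int set set set" where
  "U1_cyc n k = {\<pi>. partition_on {1..int n} \<pi> \<and>
     ugraph_connected \<pi> (merged_edges n \<pi>) \<and>
     pairing_on {1..int n} (edge_partition n \<pi>) \<and>
     (\<exists>C. ugraph_cycles \<pi> (merged_edges n \<pi>) = {C} \<and> card C = k \<and>
        (\<forall>B \<in> edge_partition n \<pi>.
           ((\<forall>r\<in>B. endpoints n \<pi> r \<notin> C) \<longrightarrow> all_opposite n \<pi> B) \<and>
           ((\<forall>r\<in>B. endpoints n \<pi> r \<in> C) \<longrightarrow> all_same n \<pi> B)))}"

text \<open>Only \<open>k \<ge> 1\<close> is meaningful.\<close>
definition U1 :: "nat \<Rightarrow> nat \<Rightarrow> int set set set" where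
  "U1 n k = (if k = 0 then {} else if k = 1 then U01 n else if k = 2 then U02 n else U1_cyc n k)"


section \<open>The permutation associated with a partition\<close>

text \<open>The pairing \<open>\<pi>\<close>-bar-3: every block of size 4 is split into its pairs of edges with the
  same orientation.\<close>
definition split_edge_partition :: "nat \<Rightarrow> int set set \<Rightarrow> int set set" where
  "split_edge_partition n \<pi> =
     {B \<in> edge_partition n \<pi>. card B \<noteq> 4} \<union>
     {{r, s} | r s. \<exists>B \<in> edge_partition n \<pi>. card B = 4 \<and> r \<in> B \<and> s \<in> B \<and> r \<noteq> s \<and>
                      same_orientation n \<pi> r s}"

definition edge_pairing :: "nat \<Rightarrow> nat \<Rightarrow> int set set \<Rightarrow> int set set" where
  "edge_pairing n k \<pi> = (if k = 2 then split_edge_partition n \<pi> else edge_partition n \<pi>)"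

definition plusminus :: "nat \<Rightarrow> int set" where
  "plusminus n = {- int n..int n} - {0}"

text \<open>For a pair \<open>{r, s}\<close> of edges this has the cycles \<open>(r, s)(-r, -s)\<close> if their orientations are
  opposite and \<open>(r, -s)(-r, s)\<close> if they are the same, where \<open>r = \<bar>x\<bar>\<close>.\<close>
definition assoc_perm :: "nat \<Rightarrow> nat \<Rightarrow> int set set \<Rightarrow> int \<Rightarrow> int" where
  "assoc_perm n k \<pi> x =
     (if x \<in> plusminus n
      then let r = \<bar>x\<bar>; s = (THE s. {r, s} \<in> edge_pairing n k \<pi>)
           in if same_orientation n \<pi> r s then - sgn x * s else sgn x * s
      else x)"


section \<open>The sets \<open>S\<^bsub>NC\<^esub>\<^bsup>\<delta>\<^esup>(n,-n)\<close> and \<open>NC\<^sub>2\<^bsup>\<delta>\<^esup>(n,-n)\<close>\<close>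

definition delta :: "int \<Rightarrow> int" where
  "delta k = - k"

text \<open>The permutation \<open>\<gamma>\<delta>\<gamma>\<inverse>\<delta>\<close>.\<close>
definition gamma_pm :: "nat \<Rightarrow> int \<Rightarrow> int" where
  "gamma_pm n = gamma n \<circ> delta \<circ> inv (gamma n) \<circ> delta"

definition SNC_delta :: "nat \<Rightarrow> (int \<Rightarrow> int) set" where
  "SNC_delta n = {\<tau>. \<tau> permutes plusminus n \<and>
     (\<forall>c \<in> cycle_partition (plusminus n) (\<tau> \<circ> delta). card c = 2) \<and>
     card (cycle_partition (plusminus n) \<tau>)
       + card (cycle_partition (plusminus n) (inv \<tau> \<circ> gamma_pm n)) = 2 * n \<and>
     partition_join (plusminus n) (cycle_partition (plusminus n) \<tau>)
       (cycle_partition (plusminus n) (gamma_pm n)) = {plusminus n}}"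

definition NC2_delta :: "nat \<Rightarrow> (int \<Rightarrow> int) set" where
  "NC2_delta n = {\<tau> \<in> SNC_delta n. \<forall>c \<in> cycle_partition (plusminus n) \<tau>. card c = 2}"

end

theory Submission
  imports Defs
begin

text \<open>
  A permutation in \<open>NC\<^sub>2\<^sup>\<delta>(n,-n)\<close> is a pairing of \<open>[n]\<close> with a sign on every pair. It prescribes a gluing of
  the edges of an \<open>n\<close>-gon: paired edges are identified with opposite orientations if the sign is
  positive, with the same orientation if it is negative. The join condition says that some pair is
  negative (\<open>join_one_block_iff\<close>). The corners that become one vertex are read off from the cycles
  of \<open>\<tau>\<gamma>\<delta>\<gamma>\<inverse>\<delta>\<close>: turning around a vertex in its two senses yields two different cycles, so there are half
  as many vertices as cycles (\<open>card_walk_cycles\<close>). Hence the genus condition says that the glued polygon has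
  exactly \<open>n/2\<close> vertices, as many as there are pairs (\<open>NC2_delta_iff\<close>).

  The glued boundary is a connected multigraph with one edge for every pair, and the boundary
  of the polygon is a closed walk in it which traverses every edge twice. With as many vertices as edges
  it has exactly one cycle, and the walk determines the signs: it crosses any cut equally often
  in both directions, and positive pairs are balanced by themselves, so a negative pair is never alone in a
  cut (\<open>opposite_crossing\<close>, \<open>same_pair_not_bridge\<close>). Bridges are therefore positive. Some pair is negative,
  and so the cycle consists of negative pairs throughout. The cases \<open>k = 1\<close>, \<open>k = 2\<close> and \<open>k \<ge> 3\<close> are those in
  which the cycle is a loop, a double edge (which the merged graph no longer shows) or a proper
  cycle. This proves the converse direction, with \<open>\<pi>\<close> the set of vertices of the glued polygon.

  In the forward direction the gluing given by \<open>\<pi>\<close> makes the blocks of \<open>\<pi>\<close> unions of vertices, and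
  the shape of the graph forces \<open>\<pi>\<close> to have at least \<open>n/2\<close> blocks. On the other hand, with more than \<open>n/2\<close> vertices the
  glued boundary would be a tree, in which all pairs are positive; but each shape provides a pair with
  the same orientation. So there are exactly \<open>n/2\<close> vertices (\<open>assoc_perm_in_NC2_delta\<close>).
\<close>


section \<open>Acyclic and unicyclic graphs\<close>
definition adj_rel :: "'v set \<Rightarrow> 'v set set \<Rightarrow> ('v \<times> 'v) set" where
  "adj_rel V E = {(x, y). x \<in> V \<and> y \<in> V \<and> {x, y} \<in> E}"

definition edges_on :: "'v set \<Rightarrow> 'v set set \<Rightarrow> bool" where
  "edges_on V E \<longleftrightarrow> (\<forall>e\<in>E. \<exists>u\<in>V. \<exists>v\<in>V. e = {u, v})"

definition component :: "'v set \<Rightarrow> 'v set set \<Rightarrow> 'v \<Rightarrow> 'v set" where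
  "component V E v = {w. (v, w) \<in> (adj_rel V E)\<^sup>*}"

lemma ugraph_connected_iff:
  "ugraph_connected V E \<longleftrightarrow> V \<noteq> {} \<and> (\<forall>u\<in>V. \<forall>v\<in>V. (u, v) \<in> (adj_rel V E)\<^sup>*)"
  by (simp add: ugraph_connected_def adj_rel_def)

lemma sym_adj_rel: "sym (adj_rel V E)"
  by (auto simp: adj_rel_def sym_def insert_commute)

lemma adj_rtrancl_sym: "(x, y) \<in> (adj_rel V E)\<^sup>* \<longleftrightarrow> (y, x) \<in> (adj_rel V E)\<^sup>*"
  by (meson symD sym_adj_rel sym_rtrancl)

lemma component_eq_iff: "component V E x = component V E y \<longleftrightarrow> (x, y) \<in> (adj_rel V E)\<^sup>*"
  unfolding component_def set_eq_iff mem_Collect_eq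
  by (meson adj_rtrancl_sym rtrancl.rtrancl_refl rtrancl_trans)

lemma adj_rtrancl_insert:
  assumes "u \<in> V" "v \<in> V"
  shows "(x, y) \<in> (adj_rel V (insert {u, v} E))\<^sup>* \<longleftrightarrow>
    (x, y) \<in> (adj_rel V E)\<^sup>* \<or>
    (x, u) \<in> (adj_rel V E)\<^sup>* \<and> (v, y) \<in> (adj_rel V E)\<^sup>* \<or>
    (x, v) \<in> (adj_rel V E)\<^sup>* \<and> (u, y) \<in> (adj_rel V E)\<^sup>*"
proof -
  have eq: "adj_rel V (insert {u, v} E) = insert (u, v) (insert (v, u) (adj_rel V E))"
    using assms by (auto simp: adj_rel_def doubleton_eq_iff)
  show ?thesis
    unfolding eq rtrancl_insert Un_iff mem_Collect_eq case_prod_conv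
    by (meson adj_rtrancl_sym rtrancl_trans)
qed

text \<open>Adding an edge fuses the components of its two ends. Counting components along such insertions
  gives both Euler inequalities below: an edge lowers their number by at most one, and by exactly one
  if it joins two different components.\<close>
lemma components_insert:
  fixes E :: "'v set set"
  assumes "u \<in> V" "v \<in> V"
  defines "K \<equiv> component V E"
  shows "component V (insert {u, v} E) ` V = insert (K u \<union> K v) (K ` V - {K u, K v})"
proof -
  let ?K' = "component V (insert {u, v} E)"
  have K': "?K' x = (if x \<in> K u \<union> K v then K u \<union> K v else K x)" for x
    unfolding K_def component_def using assms(1,2)
    by (auto simp: adj_rtrancl_insert) (meson adj_rtrancl_sym rtrancl_trans)+
  have self: "x \<in> K x" for x by (simp add: K_def component_def)
  have mem: "x \<in> K y \<longleftrightarrow> K x = K y" for x y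
    unfolding K_def component_eq_iff by (simp add: component_def adj_rtrancl_sym)
  show ?thesis
  proof (intro set_eqI iffI)
    fix X assume "X \<in> ?K' ` V"
    then obtain x where "x \<in> V" "X = ?K' x" by blast
    then show "X \<in> insert (K u \<union> K v) (K ` V - {K u, K v})"
      unfolding K' using self mem by auto
  next
    fix X assume "X \<in> insert (K u \<union> K v) (K ` V - {K u, K v})"
    then consider "X = K u \<union> K v" | x where "x \<in> V" "X = K x" "K x \<noteq> K u" "K x \<noteq> K v" by blast
    then show "X \<in> ?K' ` V"
    proof cases
      case 1
      then have "X = ?K' u" unfolding K' using self by auto
      then show ?thesis using assms(1) by blast
    next
      case 2
      then have "X = ?K' x" unfolding K' using mem by auto
      then show ?thesis using 2 by blast
    qed
  qed
qed

lemma card_components_insert: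
  assumes "finite V" "u \<in> V" "v \<in> V"
  shows "card (component V E ` V) =
    card (component V (insert {u, v} E) ` V) + (if (u, v) \<in> (adj_rel V E)\<^sup>* then 0 else 1)"
proof -
  define K where "K = component V E"
  have self: "x \<in> K x" for x by (simp add: K_def component_def)
  have mem: "x \<in> K y \<longleftrightarrow> K x = K y" for x y
    unfolding K_def component_eq_iff by (simp add: component_def adj_rtrancl_sym)
  have new: "K u \<union> K v \<notin> K ` V - {K u, K v}"
  proof
    assume "K u \<union> K v \<in> K ` V - {K u, K v}"
    then obtain x where "K u \<union> K v = K x" "K x \<noteq> K u" by auto
    then show False using self[of u] mem by blast
  qed
  have fin: "finite (K ` V)" using assms by simp
  have ins: "card (component V (insert {u, v} E) ` V) = Suc (card (K ` V - {K u, K v}))"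
    unfolding components_insert[OF assms(2,3)] K_def[symmetric] using new fin by simp
  have "card (K ` V - {K u, K v}) = card (K ` V) - card {K u, K v}"
    using assms by (intro card_Diff_subset) auto
  moreover have "card {K u, K v} \<le> card (K ` V)"
    using assms by (intro card_mono) auto
  moreover have "(u, v) \<in> (adj_rel V E)\<^sup>* \<longleftrightarrow> K u = K v" by (simp add: K_def component_eq_iff)
  ultimately show ?thesis using ins by (auto simp: K_def[symmetric] card_insert_if split: if_splits)
qed

lemma card_vertices_le:
  assumes "finite V" "finite E" "edges_on V E"
  shows "card V \<le> card (component V E ` V) + card E"
  using assms(2,3)
proof (induction E rule: finite_induct)
  case empty
  have "component V {} = (\<lambda>x. {x})"
    by (auto simp: component_def adj_rel_def)
  then show ?case by (simp add: card_image)
next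
  case (insert e E)
  then obtain u v where uv: "u \<in> V" "v \<in> V" "e = {u, v}" by (auto simp: edges_on_def)
  have "edges_on V E" using insert.prems by (auto simp: edges_on_def)
  then have "card V \<le> card (component V E ` V) + card E" using insert.IH by blast
  then show ?case
    using card_components_insert[OF assms(1) uv(1,2), of E] insert.hyps uv(3)
    by (auto split: if_splits)
qed

lemma connected_card_le:
  assumes "finite V" "finite E" "edges_on V E" "ugraph_connected V E"
  shows "card V \<le> card E + 1"
proof -
  obtain x where "x \<in> V" using assms(4) by (auto simp: ugraph_connected_iff)
  then have "component V E ` V = {component V E x}"
    using assms(4) component_eq_iff[of V E] unfolding ugraph_connected_iff by blast
  then show ?thesis using card_vertices_le[OF assms(1-3)] by simp
qed

lemma ex_simple_path:
  assumes "(u, v) \<in> r\<^sup>*"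
  shows "\<exists>vs. vs \<noteq> [] \<and> hd vs = u \<and> last vs = v \<and> distinct vs \<and>
    successively (\<lambda>x y. (x, y) \<in> r) vs"
  using assms
proof (induction rule: converse_rtrancl_induct)
  case base
  show ?case by (rule exI[of _ "[v]"]) simp
next
  case (step u w)
  then obtain vs where vs: "vs \<noteq> []" "hd vs = w" "last vs = v" "distinct vs"
    "successively (\<lambda>x y. (x, y) \<in> r) vs" by blast
  show ?case
  proof (cases "u \<in> set vs")
    case True
    then obtain as bs where "vs = as @ u # bs" by (meson split_list)
    then show ?thesis using vs
      by (intro exI[of _ "u # bs"]) (auto simp: successively_append_iff)
  next
    case False
    then show ?thesis using vs step.hyps(1)
      by (intro exI[of _ "u # vs"]) (auto simp: successively_Cons)
  qed
qed

lemma card_closed_walk_edges: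
  assumes "distinct vs" "length vs \<ge> 3"
  shows "card (closed_walk_edges vs) = length vs"
proof -
  let ?l = "length vs"
  let ?e = "\<lambda>i. {vs ! i, vs ! (Suc i mod ?l)}"
  have "inj_on ?e {..<?l}"
  proof (rule inj_onI)
    fix i j assume ij: "i \<in> {..<?l}" "j \<in> {..<?l}" "?e i = ?e j"
    have "Suc i mod ?l < ?l" "Suc j mod ?l < ?l" using assms(2) by (auto intro!: mod_less_divisor)
    then have "i = j \<or> (i = Suc j mod ?l \<and> Suc i mod ?l = j)"
      using ij assms(1) by (auto simp: doubleton_eq_iff nth_eq_iff_index_eq)
    then show "i = j" using ij(1,2) assms(2) by (auto simp: mod_Suc split: if_splits)
  qed
  moreover have "closed_walk_edges vs = ?e ` {..<?l}"
    by (auto simp: closed_walk_edges_def)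
  ultimately show ?thesis by (simp add: card_image)
qed

lemma successively_nth: "successively P xs \<Longrightarrow> Suc i < length xs \<Longrightarrow> P (xs ! i) (xs ! Suc i)"
  by (induction P xs arbitrary: i rule: successively.induct) (auto simp: nth_Cons split: nat.splits)

text \<open>A simple path that bypasses an edge closes up with it. The path has at least three vertices,
  so the closed walk has as many edges as vertices and is a cycle in the sense used here.\<close>
lemma ex_cycle_if_not_bridge:
  assumes "u \<in> V" "v \<in> V" "{u, v} \<in> E" "(u, v) \<in> (adj_rel V (E - {{u, v}}))\<^sup>*"
  shows "ugraph_cycles V E \<noteq> {}"
proof (cases "u = v")
  case True
  have "closed_walk_edges [u] = {{u}}" by (auto simp: closed_walk_edges_def)
  then have "{{u}} \<in> ugraph_cycles V E" using assms True
    unfolding ugraph_cycles_def by (intro CollectI exI[of _ "[u]"]) auto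
  then show ?thesis by blast
next
  case False
  obtain vs where vs: "vs \<noteq> []" "hd vs = u" "last vs = v" "distinct vs"
    "successively (\<lambda>x y. (x, y) \<in> adj_rel V (E - {{u, v}})) vs"
    using ex_simple_path[OF assms(4)] by blast
  have "length vs \<noteq> 1" using vs False by (auto simp: length_Suc_conv)
  moreover have "length vs \<noteq> 2"
  proof
    assume "length vs = 2"
    then obtain a b where "vs = [a, b]" by (metis length_0_conv length_Suc_conv numeral_2_eq_2)
    then show False using vs by (simp add: adj_rel_def)
  qed
  moreover have "length vs \<noteq> 0" using vs(1) by simp
  ultimately have l3: "length vs \<ge> 3" by linarith
  have nth: "(vs ! i, vs ! Suc i) \<in> adj_rel V (E - {{u, v}})" if "Suc i < length vs" for i
    using successively_nth[OF vs(5) that] .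
  have "set vs \<subseteq> V"
  proof
    fix x assume "x \<in> set vs"
    then obtain i where i: "i < length vs" "x = vs ! i" by (metis in_set_conv_nth)
    show "x \<in> V"
    proof (cases "Suc i < length vs")
      case True
      then show ?thesis using nth[OF True] i by (auto simp: adj_rel_def)
    next
      case False
      then have "i = length vs - 1" using i(1) by linarith
      then have "x = v" using i(2) vs(1,3) by (simp add: last_conv_nth)
      then show ?thesis using assms(2) by simp
    qed
  qed
  moreover have "closed_walk_edges vs \<subseteq> E"
  proof
    fix e assume "e \<in> closed_walk_edges vs"
    then obtain i where i: "i < length vs" "e = {vs ! i, vs ! (Suc i mod length vs)}"
      by (auto simp: closed_walk_edges_def)
    show "e \<in> E"
    proof (cases "Suc i < length vs")
      case True
      then show ?thesis using nth[OF True] i by (auto simp: adj_rel_def)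
    next
      case False
      then have l: "Suc i = length vs" using i by simp
      then have "vs ! i = v" using vs(1,3) by (metis last_conv_nth diff_Suc_1)
      moreover have "vs ! 0 = u" using vs(1,2) by (simp add: hd_conv_nth)
      ultimately show ?thesis using i l assms(3) by (simp add: insert_commute)
    qed
  qed
  ultimately have "closed_walk_edges vs \<in> ugraph_cycles V E"
    unfolding ugraph_cycles_def using vs l3 card_closed_walk_edges[OF vs(4) l3] by blast
  then show ?thesis by blast
qed

lemma cycles_delete_edge: "ugraph_cycles V (E - {e}) = {C \<in> ugraph_cycles V E. e \<notin> C}"
  by (auto simp: ugraph_cycles_def)

text \<open>In an acyclic graph every edge is a bridge, so each one lowers the number of components.\<close>
lemma acyclic_card_le:
  assumes "finite V" "finite E" "edges_on V E" "ugraph_cycles V E = {}"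
  shows "card (component V E ` V) + card E \<le> card V"
  using assms(2-4)
proof (induction E rule: finite_induct)
  case empty
  show ?case by (simp add: card_image_le[OF assms(1)])
next
  case (insert e E)
  then obtain u v where uv: "u \<in> V" "v \<in> V" "e = {u, v}" by (auto simp: edges_on_def)
  have E: "E = insert e E - {e}" using insert.hyps by blast
  have "edges_on V E" using insert.prems by (auto simp: edges_on_def)
  moreover have "ugraph_cycles V E = {}"
    using insert.prems cycles_delete_edge[of V "insert e E" e] E by simp
  ultimately have IH: "card (component V E ` V) + card E \<le> card V" using insert.IH by blast
  have "(u, v) \<notin> (adj_rel V E)\<^sup>*"
    using ex_cycle_if_not_bridge[OF uv(1,2), of "insert e E"] insert.prems(2) uv(3) E by auto
  then show ?case
    using IH card_components_insert[OF assms(1) uv(1,2), of E] insert.hyps uv(3) by simp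
qed

lemma acyclic_card_less:
  assumes "finite V" "V \<noteq> {}" "finite E" "edges_on V E" "ugraph_cycles V E = {}"
  shows "card E < card V"
proof -
  have "card (component V E ` V) > 0" using assms(1,2) by (simp add: card_gt_0_iff)
  then show ?thesis using acyclic_card_le[OF assms(1,3-5)] by linarith
qed

lemma connected_delete_edge:
  assumes "ugraph_connected V E" "(u, v) \<in> (adj_rel V (E - {{u, v}}))\<^sup>*"
  shows "ugraph_connected V (E - {{u, v}})"
proof -
  let ?R = "adj_rel V (E - {{u, v}})"
  have "adj_rel V E \<subseteq> ?R\<^sup>*"
  proof
    fix z assume z: "z \<in> adj_rel V E"
    obtain x y where xy: "z = (x, y)" by (cases z)
    show "z \<in> ?R\<^sup>*"
    proof (cases "{x, y} = {u, v}")
      case True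
      then show ?thesis using assms(2) adj_rtrancl_sym[of u v] xy by (auto simp: doubleton_eq_iff)
    next
      case False
      then show ?thesis using z xy by (auto simp: adj_rel_def)
    qed
  qed
  then have "(adj_rel V E)\<^sup>* \<subseteq> ?R\<^sup>*" by (metis rtrancl_idemp rtrancl_mono)
  then show ?thesis using assms(1) unfolding ugraph_connected_iff by blast
qed

lemma connected_delete_loop: "ugraph_connected V E \<Longrightarrow> ugraph_connected V (E - {{v}})"
  using connected_delete_edge[of V E v v] by simp

text \<open>The rest of the cycle leads from one end of the deleted edge to the other.\<close>
lemma connected_delete_cycle_edge:
  assumes "ugraph_connected V E" "C \<in> ugraph_cycles V E" "e \<in> C"
  shows "ugraph_connected V (E - {e})"
proof -
  obtain vs where vs: "C = closed_walk_edges vs" "vs \<noteq> []" "distinct vs" "set vs \<subseteq> V"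
      "C \<subseteq> E" "card C = length vs"
    using assms(2) by (auto simp: ugraph_cycles_def)
  let ?l = "length vs"
  let ?e = "\<lambda>i. {vs ! i, vs ! (Suc i mod ?l)}"
  have C: "C = ?e ` {..<?l}" using vs(1) by (auto simp: closed_walk_edges_def)
  have inj: "inj_on ?e {..<?l}" using vs(6) by (intro eq_card_imp_inj_on) (auto simp: C)
  obtain i where i: "i < ?l" "e = ?e i" using assms(3) C by auto
  let ?R = "adj_rel V (E - {e})"
  have step: "(vs ! j, vs ! (Suc j mod ?l)) \<in> ?R" if "j < ?l" "j \<noteq> i" for j
  proof -
    have "?e j \<noteq> e" using inj_onD[OF inj, of j i] that i by auto
    moreover have "?e j \<in> E" using that C vs(5) by blast
    moreover have "Suc j mod ?l < ?l" using vs(2) by simp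
    ultimately show ?thesis using that(1) vs(4) by (auto simp: adj_rel_def)
  qed
  have "(vs ! (Suc i mod ?l), vs ! ((Suc i + m) mod ?l)) \<in> ?R\<^sup>*" if "m < ?l" for m
    using that
  proof (induction m)
    case 0
    show ?case by simp
  next
    case (Suc m)
    let ?j = "(Suc i + m) mod ?l"
    have "?j \<noteq> i"
    proof (cases "Suc i + m < ?l")
      case True then show ?thesis by simp
    next
      case False
      then have "?j = Suc i + m - ?l" using Suc.prems i(1) by (simp add: mod_if)
      then show ?thesis using Suc.prems False by linarith
    qed
    then have "(vs ! ?j, vs ! (Suc ?j mod ?l)) \<in> ?R" using step vs(2) by simp
    moreover have "Suc ?j mod ?l = (Suc i + Suc m) mod ?l" by (simp add: mod_Suc_eq)
    ultimately show ?case using Suc by (auto intro: rtrancl_into_rtrancl)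
  qed
  moreover have "Suc i + (?l - 1) = i + ?l" using i(1) by linarith
  then have "(Suc i + (?l - 1)) mod ?l = i" using i(1) by simp
  ultimately have "(vs ! (Suc i mod ?l), vs ! i) \<in> ?R\<^sup>*"
    using i(1) \<open>(Suc i + (?l - 1)) mod ?l = i\<close> by (metis diff_less length_greater_0_conv vs(2) zero_less_one)
  then have "(vs ! i, vs ! (Suc i mod ?l)) \<in> ?R\<^sup>*" by (simp add: adj_rtrancl_sym)
  then show ?thesis using connected_delete_edge[OF assms(1)] i(2) by simp
qed

text \<open>Deleting an edge of a cycle would leave a connected graph with too few edges.\<close>
lemma connected_acyclicI:
  assumes "finite V" "finite E" "edges_on V E" "ugraph_connected V E" "card V = card E + 1"
  shows "ugraph_cycles V E = {}"
proof (rule ccontr)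
  assume "ugraph_cycles V E \<noteq> {}"
  then obtain C where C: "C \<in> ugraph_cycles V E" by blast
  then have "C \<noteq> {}" "C \<subseteq> E" by (auto simp: ugraph_cycles_def)
  then obtain e where e: "e \<in> C" "e \<in> E" by blast
  have "card V \<le> card (E - {e}) + 1"
    using connected_delete_cycle_edge[OF assms(4) C e(1)] assms(1-3)
    by (intro connected_card_le) (auto simp: edges_on_def)
  moreover have "card (E - {e}) + 1 = card E" 
    using card_Suc_Diff1[OF assms(2) e(2)] by simp
  ultimately show False using assms(5) by linarith
qed

text \<open>Deleting an edge of one cycle leaves a tree, so any other cycle must use that edge too. Hence
  any two cycles contain each other.\<close>
lemma unique_cycle:
  assumes "finite V" "finite E" "edges_on V E" "ugraph_connected V E" "card V = card E"
  shows "\<exists>C. ugraph_cycles V E = {C}"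
proof -
  have "V \<noteq> {}" using assms(4) by (simp add: ugraph_connected_iff)
  then have ne: "ugraph_cycles V E \<noteq> {}" using acyclic_card_less[OF assms(1) _ assms(2,3)] assms(5) by auto
  have sub: "C \<subseteq> D" if C: "C \<in> ugraph_cycles V E" and D: "D \<in> ugraph_cycles V E" for C D
  proof
    fix e assume e: "e \<in> C"
    have "C \<subseteq> E" using C by (auto simp: ugraph_cycles_def)
    then have "card V = card (E - {e}) + 1"
      using e card_Suc_Diff1[OF assms(2), of e] assms(5) by auto
    then have "ugraph_cycles V (E - {e}) = {}"
      using connected_delete_cycle_edge[OF assms(4) C e] assms(1-3)
      by (intro connected_acyclicI) (auto simp: edges_on_def)
    then show "e \<in> D" using D unfolding cycles_delete_edge by blast
  qed
  obtain C where "C \<in> ugraph_cycles V E" using ne by blast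
  then show ?thesis using sub by blast
qed

text \<open>The set is the component of one end of the bridge.\<close>
lemma ex_cut:
  assumes "(u, v) \<notin> (adj_rel V (E - {e}))\<^sup>*"
  shows "\<exists>S. u \<in> S \<and> v \<notin> S \<and> (\<forall>x\<in>V. \<forall>y\<in>V. {x, y} \<in> E \<longrightarrow> {x, y} \<noteq> e \<longrightarrow> (x \<in> S \<longleftrightarrow> y \<in> S))"
proof (intro exI[of _ "component V (E - {e}) u"] conjI ballI impI)
  fix x y assume "x \<in> V" "y \<in> V" "{x, y} \<in> E" "{x, y} \<noteq> e"
  then have "(x, y) \<in> (adj_rel V (E - {e}))\<^sup>*" by (auto simp: adj_rel_def)
  then show "x \<in> component V (E - {e}) u \<longleftrightarrow> y \<in> component V (E - {e}) u"
    unfolding component_def mem_Collect_eq by (meson adj_rtrancl_sym rtrancl_trans)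
qed (use assms in \<open>auto simp: component_def\<close>)


section \<open>Signed pairings\<close>
lemma gamma_in: "k \<in> {1..int n} \<Longrightarrow> gamma n k \<in> {1..int n}"
  by (auto simp: gamma_def)

lemma gamma_permutes:
  assumes "n \<ge> 1"
  shows "gamma n permutes {1..int n}"
proof (rule bij_imp_permutes)
  have "inj_on (gamma n) {1..int n}"
    by (auto simp: inj_on_def gamma_def split: if_splits)
  moreover have "gamma n ` {1..int n} \<subseteq> {1..int n}" using gamma_in by blast
  ultimately show "bij_betw (gamma n) {1..int n} {1..int n}"
    using endo_inj_surj[of "{1..int n}" "gamma n"] by (simp add: bij_betw_def)
qed (use assms in \<open>auto simp: gamma_def\<close>)

lemma gamma_eq_iff: "n \<ge> 1 \<Longrightarrow> gamma n x = gamma n y \<longleftrightarrow> x = y"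
  using permutes_inj[OF gamma_permutes] by (auto dest: injD)

lemma gamma_surj:
  assumes "n \<ge> 1" "k \<in> {1..int n}"
  obtains j where "j \<in> {1..int n}" "gamma n j = k"
  using permutes_image[OF gamma_permutes[OF assms(1)]] assms(2) by (metis imageE)

lemma gamma_induct [consumes 1, case_names one step]:
  assumes "k \<in> {1..int n}" "P 1"
    "\<And>j. j \<in> {1..int n} \<Longrightarrow> P j \<Longrightarrow> P (gamma n j)"
  shows "P k"
proof -
  have "k \<le> int n \<longrightarrow> P k" if "k \<ge> 1" using that
  proof (induction k rule: int_ge_induct)
    case base show ?case using assms(2) by simp
  next
    case (step i)
    then show ?case using assms(3)[of i] by (auto simp: gamma_def)
  qed
  then show ?thesis using assms(1) by simp
qed

lemma plusminus_iff: "x \<in> plusminus n \<longleftrightarrow> \<bar>x\<bar> \<in> {1..int n}"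
  by (auto simp: plusminus_def)

lemma uminus_in_plusminus [simp]: "- x \<in> plusminus n \<longleftrightarrow> x \<in> plusminus n"
  by (simp add: plusminus_iff)

lemma finite_plusminus [simp]: "finite (plusminus n)"
  by (simp add: plusminus_def)

lemma card_plusminus: "card (plusminus n) = 2 * n"
  by (simp add: plusminus_def)

lemma plusminus_cases:
  assumes "n \<ge> 1" "x \<in> plusminus n"
  obtains "x \<in> {1..int n}" | j where "j \<in> {1..int n}" "x = - gamma n j"
proof (cases "x > 0")
  case True
  then show ?thesis using that(1) assms(2) by (simp add: plusminus_iff)
next
  case False
  then have "- x \<in> {1..int n}" using assms(2) by (auto simp: plusminus_iff)
  then obtain j where "j \<in> {1..int n}" "gamma n j = - x" using gamma_surj[OF assms(1)] by blast
  then show ?thesis using that(2) by auto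
qed

lemma gamma_pm_pos:
  assumes "n \<ge> 1" "x \<in> {1..int n}"
  shows "gamma_pm n x = gamma n x"
proof -
  have "inv (gamma n) (- x) = - x"
    using assms by (simp add: permutes_inv_eq[OF gamma_permutes] gamma_def)
  then show ?thesis by (simp add: gamma_pm_def delta_def)
qed

lemma gamma_pm_neg:
  assumes "n \<ge> 1" "x \<in> {1..int n}"
  shows "gamma_pm n (- gamma n x) = - x"
  using assms by (simp add: gamma_pm_def delta_def permutes_inverses[OF gamma_permutes])
    (simp add: gamma_def)

lemma gamma_pm_in:
  assumes "n \<ge> 1" "x \<in> plusminus n"
  shows "gamma_pm n x \<in> plusminus n"
  using assms
proof (cases rule: plusminus_cases)
  case 1
  then show ?thesis using gamma_in[of x n] gamma_pm_pos[OF assms(1)] by (simp add: plusminus_iff)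
next
  case (2 j)
  then show ?thesis using gamma_pm_neg[OF assms(1)] by (simp add: plusminus_iff)
qed

text \<open>The permutation \<open>\<gamma>\<delta>\<gamma>\<inverse>\<delta>\<close> has the two cycles \<open>(1, \<dots>, n)\<close> and \<open>(-n, \<dots>, -1)\<close>; conjugation by
  \<open>\<delta>\<close> exchanges and reverses them.\<close>
lemma gamma_pm_uminus:
  "n \<ge> 1 \<Longrightarrow> x \<in> plusminus n \<Longrightarrow> gamma_pm n (- gamma_pm n x) = - x"
  by (erule (1) plusminus_cases) (auto simp: gamma_pm_pos gamma_pm_neg)

lemma gamma_pm_permutes:
  assumes "n \<ge> 1"
  shows "gamma_pm n permutes plusminus n"
proof (rule bij_imp_permutes)
  have "inj_on (gamma_pm n) (plusminus n)"
    by (rule inj_onI) (metis assms gamma_pm_uminus neg_equal_iff_equal)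
  then show "bij_betw (gamma_pm n) (plusminus n) (plusminus n)"
    using endo_inj_surj[of "plusminus n" "gamma_pm n"] gamma_pm_in[OF assms]
    by (auto simp: bij_betw_def)
next
  fix x assume "x \<notin> plusminus n"
  then have x: "x \<notin> {1..int n}" "- x \<notin> {1..int n}" by (auto simp: plusminus_iff)
  then have "inv (gamma n) (- x) = - x" "gamma n x = x"
    using permutes_not_in[OF gamma_permutes[OF assms]]
    by (auto simp: permutes_inv_eq[OF gamma_permutes[OF assms]])
  then show "gamma_pm n x = x" by (simp add: gamma_pm_def delta_def)
qed

text \<open>This is stated for injections because \<open>\<tau>\<delta>\<close> moves infinitely many integers. A finite orbit of an
  injection returns to its starting point.\<close>
lemma card_orbit_eq_2_iff:
  assumes "inj f"
  shows "card (orbit f x) = 2 \<longleftrightarrow> f x \<noteq> x \<and> f (f x) = x"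
proof
  assume c: "card (orbit f x) = 2"
  have "{y. \<exists>m. y = (f ^^ m) x} \<subseteq> insert x (orbit f x)"
  proof
    fix y assume "y \<in> {y. \<exists>m. y = (f ^^ m) x}"
    then obtain m where "y = (f ^^ m) x" by blast
    then show "y \<in> insert x (orbit f x)" by (cases "m = 0") (auto simp: orbit_altdef)
  qed
  moreover have "finite (orbit f x)" using c by (simp add: card_ge_0_finite)
  ultimately obtain m where "m > 0" "(f ^^ m) x = x"
    using funpow_inj_finite[OF assms, of x] by (metis finite.insertI finite_subset)
  then have x: "x \<in> orbit f x" unfolding orbit_altdef by (metis (mono_tags, lifting) mem_Collect_eq)
  have ne: "f x \<noteq> x" using c by (metis orbit_eq_singleton_iff card_1_singleton_iff One_nat_def n_not_Suc_n Suc_1)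
  have "orbit f x = {x, f x}"
    using c x ne orbit.base[of f x] by (auto simp: card_2_iff)
  then have "f (f x) = x \<or> f (f x) = f x" using orbit.step[OF orbit.base, of f x] by auto
  then show "f x \<noteq> x \<and> f (f x) = x" using ne injD[OF assms, of "f x" x] by blast
next
  assume f: "f x \<noteq> x \<and> f (f x) = x"
  have "y \<in> {x, f x}" if "y \<in> orbit f x" for y
    using that
  proof (induction rule: orbit.induct)
    case base
    show ?case by simp
  next
    case (step y)
    then consider "y = x" | "y = f x" by blast
    then show ?case using f by cases auto
  qed
  moreover have "f x \<in> orbit f x" "x \<in> orbit f x"
    using f orbit.base[of f x] orbit.step[OF orbit.base, of f x] by auto
  ultimately have "orbit f x = {x, f x}" by blast
  then show "card (orbit f x) = 2" using f by auto
qed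

lemma partition_on_cycle_partition:
  assumes "f permutes A" "finite A"
  shows "partition_on A (cycle_partition A f)"
proof (rule partition_onI)
  have self: "x \<in> orbit f x" for x
    using permutation_self_in_orbit assms by (metis permutation_permutes)
  show "\<Union> (cycle_partition A f) = A"
    using permutes_orbit_subset[OF assms(1)] self by (auto simp: cycle_partition_def)
  show "{} \<notin> cycle_partition A f"
    using self by (auto simp: cycle_partition_def)
  fix p q assume "p \<in> cycle_partition A f" "q \<in> cycle_partition A f" "p \<noteq> q"
  then show "disjnt p q"
    using orbit_cyclic_eq3[OF cyclic_on_orbit[OF assms]]
    unfolding cycle_partition_def disjnt_iff by (metis imageE)
qed

text \<open>The elements of \<open>NC\<^sub>2\<^sup>\<delta>(n,-n)\<close> with the genus and the connectivity condition removed. Such a \<open>\<tau>\<close> is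
  a pairing \<open>r \<mapsto> \<bar>\<tau> r\<bar>\<close> of \<open>[n]\<close> in which each pair carries a sign, that of \<open>\<tau> r\<close>: positive for the
  cycles \<open>(r,s)(-r,-s)\<close> and negative for \<open>(r,-s)(-r,s)\<close>.\<close>
locale signed_pairing =
  fixes n :: nat and \<tau> :: "int \<Rightarrow> int"
  assumes n_pos: "n \<ge> 1"
    and outside: "x \<notin> plusminus n \<Longrightarrow> \<tau> x = x"
    and maps: "x \<in> plusminus n \<Longrightarrow> \<tau> x \<in> plusminus n"
    and involutive: "x \<in> plusminus n \<Longrightarrow> \<tau> (\<tau> x) = x"
    and not_fixed: "x \<in> plusminus n \<Longrightarrow> \<tau> x \<noteq> x"
    and not_negated: "x \<in> plusminus n \<Longrightarrow> \<tau> x \<noteq> - x"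
    and odd: "x \<in> plusminus n \<Longrightarrow> \<tau> (- x) = - \<tau> x"
begin

lemma permutes: "\<tau> permutes plusminus n"
proof (rule bij_imp_permutes)
  show "bij_betw \<tau> (plusminus n) (plusminus n)"
    by (rule bij_betw_byWitness[where f' = \<tau>]) (auto simp: involutive maps)
qed (rule outside)

lemma inv_eq: "inv \<tau> = \<tau>"
proof (rule inv_unique_comp)
  show "\<tau> \<circ> \<tau> = id" by (rule ext) (metis comp_apply id_apply involutive outside)
  then show "\<tau> \<circ> \<tau> = id" .
qed

end

text \<open>If \<open>\<tau>\<close> and \<open>\<tau>\<delta>\<close> are both involutions, then \<open>\<tau>\<close> commutes with \<open>\<delta>\<close>.\<close>
lemma cycles_2_and_delta_cycles_2_iff:
  assumes "n \<ge> 1" "\<tau> permutes plusminus n"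
  shows "(\<forall>c\<in>cycle_partition (plusminus n) \<tau>. card c = 2) \<and>
      (\<forall>c\<in>cycle_partition (plusminus n) (\<tau> \<circ> delta). card c = 2)
    \<longleftrightarrow> signed_pairing n \<tau>" (is "?L \<longleftrightarrow> _")
proof -
  have inj: "inj \<tau>" using permutes_inj[OF assms(2)] .
  have inj': "inj (\<tau> \<circ> delta)" using inj by (intro inj_compose) (auto simp: inj_def delta_def)
  have "?L \<longleftrightarrow> (\<forall>x\<in>plusminus n. \<tau> x \<noteq> x \<and> \<tau> (\<tau> x) = x \<and> \<tau> (- x) \<noteq> x \<and> \<tau> (- \<tau> (- x)) = x)"
    unfolding cycle_partition_def
    by (simp add: card_orbit_eq_2_iff[OF inj] card_orbit_eq_2_iff[OF inj'] delta_def) blast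
  also have "\<dots> \<longleftrightarrow> signed_pairing n \<tau>"
  proof
    assume L: "\<forall>x\<in>plusminus n. \<tau> x \<noteq> x \<and> \<tau> (\<tau> x) = x \<and> \<tau> (- x) \<noteq> x \<and> \<tau> (- \<tau> (- x)) = x"
    have maps: "x \<in> plusminus n \<Longrightarrow> \<tau> x \<in> plusminus n" for x
      using permutes_in_image[OF assms(2)] by simp
    have odd: "\<tau> (- x) = - \<tau> x" if x: "x \<in> plusminus n" for x
    proof -
      have "\<tau> (- \<tau> (- x)) = x" using L x by blast
      moreover have "\<tau> (\<tau> (- \<tau> (- x))) = - \<tau> (- x)" using L x maps uminus_in_plusminus by blast
      ultimately show ?thesis by simp
    qed
    show "signed_pairing n \<tau>"
    proof
      fix x assume x: "x \<in> plusminus n"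
      show "\<tau> x \<noteq> - x" using L x uminus_in_plusminus by (metis minus_minus)
    qed (use assms(1) L maps odd permutes_not_in[OF assms(2)] in auto)
  next
    assume "signed_pairing n \<tau>"
    then interpret signed_pairing n \<tau> .
    show "\<forall>x\<in>plusminus n. \<tau> x \<noteq> x \<and> \<tau> (\<tau> x) = x \<and> \<tau> (- x) \<noteq> x \<and> \<tau> (- \<tau> (- x)) = x"
    proof
      fix x assume x: "x \<in> plusminus n"
      then have "\<tau> (- x) \<noteq> x" using odd not_negated by (metis minus_minus)
      then show "\<tau> x \<noteq> x \<and> \<tau> (\<tau> x) = x \<and> \<tau> (- x) \<noteq> x \<and> \<tau> (- \<tau> (- x)) = x"
        using x involutive not_fixed odd by simp
    qed
  qed
  finally show ?thesis .
qed

context signed_pairing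
begin

lemma card_cycles: "card (cycle_partition (plusminus n) \<tau>) = n"
proof -
  let ?P = "cycle_partition (plusminus n) \<tau>"
  have P: "partition_on (plusminus n) ?P"
    using partition_on_cycle_partition[OF permutes] by simp
  have "\<forall>c\<in>?P. card c = 2"
    using cycles_2_and_delta_cycles_2_iff[OF n_pos permutes] signed_pairing_axioms by blast
  moreover have "finite ?P" by (simp add: cycle_partition_def)
  ultimately have "2 * card ?P = card (\<Union> ?P)"
    using P by (intro card_partition) (auto simp: partition_on_def disjoint_def)
  then show ?thesis using partition_onD1[OF P] card_plusminus by simp
qed

text \<open>The two cycles of \<open>\<gamma>\<delta>\<gamma>\<inverse>\<delta>\<close> are the positive and the negative integers, so the join is one block
  exactly if some cycle of \<open>\<tau>\<close> has elements of both signs.\<close>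
lemma join_one_block_iff:
  "partition_join (plusminus n) (cycle_partition (plusminus n) \<tau>)
      (cycle_partition (plusminus n) (gamma_pm n)) = {plusminus n}
    \<longleftrightarrow> (\<exists>r\<in>{1..int n}. \<tau> r < 0)"
proof -
  define R where "R = {(x, y). \<exists>B \<in> cycle_partition (plusminus n) \<tau> \<union>
      cycle_partition (plusminus n) (gamma_pm n). x \<in> B \<and> y \<in> B}"
  have join: "partition_join (plusminus n) (cycle_partition (plusminus n) \<tau>)
      (cycle_partition (plusminus n) (gamma_pm n)) = plusminus n // R\<^sup>+"
    by (simp add: partition_join_def R_def)
  have "sym R" by (auto simp: R_def sym_def)
  then have sym: "sym (R\<^sup>+)" by (rule sym_trancl)
  have P: "partition_on (plusminus n) (cycle_partition (plusminus n) \<tau>)"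
    "partition_on (plusminus n) (cycle_partition (plusminus n) (gamma_pm n))"
    by (rule partition_on_cycle_partition[OF permutes finite_plusminus]
        partition_on_cycle_partition[OF gamma_pm_permutes[OF n_pos] finite_plusminus])+
  have sub: "R \<subseteq> plusminus n \<times> plusminus n"
    using P[THEN partition_onD1] by (auto simp: R_def)
  have self: "x \<in> orbit \<tau> x" "x \<in> orbit (gamma_pm n) x" for x
    using permutation_self_in_orbit permutes gamma_pm_permutes[OF n_pos] finite_plusminus
    by (metis permutation_permutes)+
  have Rself: "(x, x) \<in> R" if "x \<in> plusminus n" for x
    using that self(1)[of x] unfolding R_def cycle_partition_def by blast
  have R\<tau>: "(x, \<tau> x) \<in> R" and Rg: "(x, gamma_pm n x) \<in> R" if "x \<in> plusminus n" for x
    using that self orbit.base[of \<tau> x] orbit.base[of "gamma_pm n" x]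
    by (auto simp: R_def cycle_partition_def)
  show ?thesis unfolding join
  proof
    assume one: "plusminus n // R\<^sup>+ = {plusminus n}"
    show "\<exists>r\<in>{1..int n}. \<tau> r < 0"
    proof (rule ccontr)
      assume "\<not> ?thesis"
      then have pos: "\<tau> r > 0" if "r \<in> {1..int n}" for r
        using that maps[of r] by (force simp: plusminus_iff)
      have orb: "y > 0" if "y \<in> orbit f x" "x \<in> {1..int n}"
        "\<And>z. z \<in> {1..int n} \<Longrightarrow> f z \<in> {1..int n}" for f x y
      proof -
        have "y \<in> {1..int n}" using that by induction auto
        then show ?thesis by simp
      qed
      have m1: "\<tau> z \<in> {1..int n}" if "z \<in> {1..int n}" for z
        using pos[OF that] maps[of z] that by (auto simp: plusminus_iff)
      have m2: "gamma_pm n z \<in> {1..int n}" if "z \<in> {1..int n}" for z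
        using gamma_in[OF that] gamma_pm_pos[OF n_pos that] by simp
      have step: "y > 0" if xy: "(x, y) \<in> R" and x: "x > 0" for x y
      proof -
        have x': "x \<in> {1..int n}" using sub xy x by (auto simp: plusminus_iff)
        obtain B where B: "B \<in> cycle_partition (plusminus n) \<tau> \<union>
            cycle_partition (plusminus n) (gamma_pm n)" "x \<in> B" "y \<in> B"
          using xy by (auto simp: R_def)
        then have "y \<in> orbit \<tau> x \<or> y \<in> orbit (gamma_pm n) x"
          unfolding cycle_partition_def
          using orbit_cyclic_eq3[OF cyclic_on_orbit[OF permutes finite_plusminus]]
            orbit_cyclic_eq3[OF cyclic_on_orbit[OF gamma_pm_permutes[OF n_pos] finite_plusminus]]
          by auto
        then show ?thesis using orb[of y \<tau> x] orb[of y "gamma_pm n" x] x' m1 m2 by blast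
      qed
      have "y > 0" if "(x, y) \<in> R\<^sup>+" "x > 0" for x y
        using that by (induction rule: trancl_induct) (auto intro: step)
      moreover have "1 \<in> plusminus n" "- 1 \<in> plusminus n" using n_pos by (auto simp: plusminus_iff)
      then have "(1, - 1) \<in> R\<^sup>+"
        using one quotientI[of 1 "plusminus n" "R\<^sup>+"] by auto
      ultimately show False by fastforce
    qed
  next
    assume "\<exists>r\<in>{1..int n}. \<tau> r < 0"
    then obtain r where r: "r \<in> {1..int n}" "\<tau> r < 0" by blast
    have pos: "(1, k) \<in> R\<^sup>+" if "k \<in> {1..int n}" for k
      using that
    proof (induction rule: gamma_induct)
      case one
      have "1 \<in> plusminus n" using n_pos by (auto simp: plusminus_iff)
      then show ?case using Rself by blast
    next
      case (step j)
      then have "(j, gamma n j) \<in> R"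
        using Rg[of j] gamma_pm_pos[OF n_pos, of j] by (simp add: plusminus_iff)
      then show ?case using step.IH by (meson trancl.trancl_into_trancl)
    qed
    have neg: "(- 1, - k) \<in> R\<^sup>+" if "k \<in> {1..int n}" for k
      using that
    proof (induction rule: gamma_induct)
      case one
      have "- 1 \<in> plusminus n" using n_pos by (auto simp: plusminus_iff)
      then show ?case using Rself by blast
    next
      case (step j)
      then have "(- gamma n j, - j) \<in> R"
        using Rg[of "- gamma n j"] gamma_pm_neg[OF n_pos, of j] gamma_in[of j n]
        by (simp add: plusminus_iff)
      then show ?case using step.IH by (meson \<open>sym R\<close> symD trancl.trancl_into_trancl)
    qed
    have "- \<tau> r \<in> {1..int n}" using r maps[of r] by (auto simp: plusminus_iff)
    from neg[OF this] have "(- 1, \<tau> r) \<in> R\<^sup>+" by simp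
    moreover have "(r, \<tau> r) \<in> R\<^sup>+" using R\<tau>[of r] r(1) by (auto simp: plusminus_iff)
    ultimately have link: "(1, - 1) \<in> R\<^sup>+" using pos[OF r(1)] sym by (meson symD trancl_trans)
    have all: "(1, x) \<in> R\<^sup>+" if "x \<in> plusminus n" for x
    proof (cases "x > 0")
      case True
      then show ?thesis using pos that by (simp add: plusminus_iff)
    next
      case False
      then have "- x \<in> {1..int n}" using that by (auto simp: plusminus_iff)
      then show ?thesis using neg[of "- x"] link by (auto intro: trancl_trans)
    qed
    have "R\<^sup>+ `` {x} = plusminus n" if "x \<in> plusminus n" for x
    proof
      show "R\<^sup>+ `` {x} \<subseteq> plusminus n" using trancl_subset_Sigma[OF sub] by blast
      show "plusminus n \<subseteq> R\<^sup>+ `` {x}" using all that sym by (auto intro: trancl_trans dest: symD)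
    qed
    moreover have "r \<in> plusminus n" using r(1) by (simp add: plusminus_iff)
    ultimately show "plusminus n // R\<^sup>+ = {plusminus n}" by (auto simp: quotient_def)
  qed
qed

end

lemma NC2_delta_iff:
  assumes "n \<ge> 1"
  shows "\<tau> \<in> NC2_delta n \<longleftrightarrow> signed_pairing n \<tau> \<and>
    card (cycle_partition (plusminus n) (\<tau> \<circ> gamma_pm n)) = n \<and> (\<exists>r\<in>{1..int n}. \<tau> r < 0)"
proof (cases "signed_pairing n \<tau>")
  case True
  then interpret signed_pairing n \<tau> .
  show ?thesis
    unfolding NC2_delta_def SNC_delta_def
    using permutes cycles_2_and_delta_cycles_2_iff[OF assms permutes] True
    by (auto simp: card_cycles inv_eq join_one_block_iff)
next
  case False
  then show ?thesis
    using cycles_2_and_delta_cycles_2_iff[OF assms, of \<tau>]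
    unfolding NC2_delta_def SNC_delta_def by blast
qed


section \<open>The vertices of the glued polygon\<close>
text \<open>Glue the edges of an \<open>n\<close>-gon in the pairs and with the orientations that \<open>\<tau>\<close> prescribes. The
  elements \<open>x > 0\<close> and \<open>-x\<close> stand for the two ends of the edge \<open>x\<close>, at the corners \<open>\<gamma>(x)\<close> and \<open>x\<close>. Turning
  around a vertex of the glued surface, from the end of one edge to the next, follows a cycle of
  \<open>\<tau>\<gamma>\<delta>\<gamma>\<inverse>\<delta>\<close>. Every corner is an end of two edges, one for either sense of rotation.\<close>
definition vertex_label :: "nat \<Rightarrow> int \<Rightarrow> int" where
  "vertex_label n x = (if x > 0 then gamma n x else - x)"

text \<open>The vertices of the glued polygon, as sets of corners.\<close>
definition vertex_partition :: "nat \<Rightarrow> (int \<Rightarrow> int) \<Rightarrow> int set set" where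
  "vertex_partition n \<tau> =
     (\<lambda>C. vertex_label n ` C) ` cycle_partition (plusminus n) (\<tau> \<circ> gamma_pm n)"

lemma edge_eq: "edge n \<pi> k = (block_of \<pi> (gamma n k), block_of \<pi> k)"
  by (simp add: arc_to_ends_def part_digraph_def)

lemma endpoints_eq: "endpoints n \<pi> k = {block_of \<pi> (gamma n k), block_of \<pi> k}"
  by (simp add: endpoints_def part_digraph_def)

lemma block_of_eqI:
  assumes "partition_on A \<pi>" "B \<in> \<pi>" "x \<in> B"
  shows "block_of \<pi> x = B"
  unfolding block_of_def
  by (rule the_equality) (use assms in \<open>auto simp: partition_on_def disjoint_def\<close>)

lemma block_of_in:
  assumes "partition_on A \<pi>" "x \<in> A"
  shows "block_of \<pi> x \<in> \<pi>" "x \<in> block_of \<pi> x"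
proof -
  obtain B where "B \<in> \<pi>" "x \<in> B" using assms by (auto simp: partition_on_def)
  then show "block_of \<pi> x \<in> \<pi>" "x \<in> block_of \<pi> x" using block_of_eqI[OF assms(1)] by auto
qed

text \<open>The graph of \<open>\<pi>\<close> respects the gluing: paired edges coincide, with the orientation that their
  sign demands.\<close>
definition realizes :: "nat \<Rightarrow> (int \<Rightarrow> int) \<Rightarrow> int set set \<Rightarrow> bool" where
  "realizes n \<tau> \<pi> \<longleftrightarrow> partition_on {1..int n} \<pi> \<and>
     (\<forall>r\<in>{1..int n}. (\<tau> r > 0 \<longrightarrow> edge n \<pi> r = prod.swap (edge n \<pi> (\<tau> r))) \<and>
        (\<tau> r < 0 \<longrightarrow> edge n \<pi> r = edge n \<pi> (- \<tau> r)))"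

context signed_pairing
begin

lemma walk_permutes: "\<tau> \<circ> gamma_pm n permutes plusminus n"
  using permutes_compose[OF gamma_pm_permutes[OF n_pos] permutes] .

lemma vertex_label_in: "x \<in> plusminus n \<Longrightarrow> vertex_label n x \<in> {1..int n}"
  using gamma_in[of x n] by (auto simp: vertex_label_def plusminus_iff)

text \<open>The corner label is two-to-one, with deck transformation \<open>x \<mapsto> - \<gamma>\<delta>\<gamma>\<inverse>\<delta> x\<close>.\<close>
lemma vertex_label_eq_iff:
  assumes "x \<in> plusminus n" "y \<in> plusminus n"
  shows "vertex_label n x = vertex_label n y \<longleftrightarrow> y = x \<or> y = - gamma_pm n x"
proof -
  have pos: "gamma n j > 0" if "j \<in> {1..int n}" for j using gamma_in[OF that] by simp
  have lab: "vertex_label n j = gamma n j" "vertex_label n (- gamma n j) = gamma n j"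
    if "j \<in> {1..int n}" for j
    using pos[OF that] that by (auto simp: vertex_label_def)
  note simps = lab gamma_pm_pos[OF n_pos] gamma_pm_neg[OF n_pos] gamma_eq_iff[OF n_pos]
  show ?thesis using n_pos assms(1)
  proof (cases rule: plusminus_cases)
    case x: 1
    show ?thesis using n_pos assms(2)
    proof (cases rule: plusminus_cases)
      case 1
      then show ?thesis using x pos[OF x] by (auto simp: simps)
    next
      case (2 k)
      then show ?thesis using x pos[OF 2(1)] by (auto simp: simps)
    qed
  next
    case x: (2 j)
    show ?thesis using n_pos assms(2)
    proof (cases rule: plusminus_cases)
      case 1
      then show ?thesis using x pos[OF x(1)] by (auto simp: simps)
    next
      case (2 k)
      then show ?thesis using x pos[OF 2(1)] by (auto simp: simps)
    qed
  qed
qed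

text \<open>The deck transformation reverses the direction of \<open>\<tau>\<gamma>\<delta>\<gamma>\<inverse>\<delta>\<close>, so it permutes the cycles of
  that permutation.\<close>
lemma walk_mirror:
  assumes "x \<in> plusminus n"
  shows "(\<tau> \<circ> gamma_pm n) (- gamma_pm n ((\<tau> \<circ> gamma_pm n) x)) = - gamma_pm n x"
proof -
  have g: "gamma_pm n x \<in> plusminus n" using gamma_pm_in[OF n_pos assms] .
  then show ?thesis using gamma_pm_uminus[OF n_pos maps[OF g]] odd[OF maps[OF g]] involutive[OF g]
    by simp
qed

abbreviation walk_orbit :: "int \<Rightarrow> int set" where
  "walk_orbit \<equiv> orbit (\<tau> \<circ> gamma_pm n)"

lemma walk_orbit_eq: "y \<in> walk_orbit x \<Longrightarrow> walk_orbit y = walk_orbit x"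
  using orbit_cyclic_eq3[OF cyclic_on_orbit[OF walk_permutes finite_plusminus]] by blast

lemma self_in_walk_orbit: "x \<in> walk_orbit x"
  using permutation_self_in_orbit walk_permutes finite_plusminus by (metis permutation_permutes)

lemma walk_orbit_subset: "x \<in> plusminus n \<Longrightarrow> walk_orbit x \<subseteq> plusminus n"
  by (rule permutes_orbit_subset[OF walk_permutes])

lemma mirror_in: "x \<in> plusminus n \<Longrightarrow> - gamma_pm n x \<in> plusminus n"
  using gamma_pm_in[OF n_pos] by simp

lemma walk_orbit_mirror_cong:
  assumes "y \<in> walk_orbit x" "x \<in> plusminus n"
  shows "walk_orbit (- gamma_pm n y) = walk_orbit (- gamma_pm n x)"
proof -
  have step: "walk_orbit (- gamma_pm n ((\<tau> \<circ> gamma_pm n) z)) = walk_orbit (- gamma_pm n z)"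
    if "z \<in> plusminus n" for z
    using walk_orbit_eq[OF orbit.base] walk_mirror[OF that] by metis
  show ?thesis using assms
  proof (induction rule: orbit.induct)
    case base
    then show ?case by (rule step)
  next
    case (step y)
    then show ?case using \<open>\<And>z. z \<in> plusminus n \<Longrightarrow> _ z\<close> walk_orbit_subset by blast
  qed
qed

text \<open>A reversal of a cycle either fixes an element or exchanges two consecutive ones. The former is
  impossible since the deck transformation has no fixed points; the latter would give some \<open>z\<close> with
  \<open>\<tau> z = - z\<close>.\<close>
lemma mirror_notin_walk_orbit:
  assumes "x \<in> plusminus n"
  shows "- gamma_pm n x \<notin> walk_orbit x"
proof
  define p where "p = \<tau> \<circ> gamma_pm n"
  assume "- gamma_pm n x \<in> walk_orbit x"
  then obtain m where m: "- gamma_pm n x = (p ^^ m) x"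
    by (auto simp: orbit_altdef p_def)
  have inj: "inj p" using permutes_inj[OF walk_permutes] by (simp add: p_def)
  have injpow: "inj (p ^^ i)" for i using inj_fn[OF inj] .
  have in_pm: "(p ^^ i) x \<in> plusminus n" for i
    using funpow_in_orbit[OF self_in_walk_orbit] walk_orbit_subset[OF assms]
    unfolding p_def by blast
  have fold: "(p ^^ i) (- gamma_pm n ((p ^^ i) x)) = - gamma_pm n x" for i
  proof (induction i)
    case (Suc i)
    have "(p ^^ Suc i) (- gamma_pm n ((p ^^ Suc i) x))
        = (p ^^ i) (p (- gamma_pm n (p ((p ^^ i) x))))"
      unfolding funpow_Suc_right comp_def by (simp add: funpow_swap1)
    then show ?case using walk_mirror[OF in_pm[of i]] Suc unfolding p_def[symmetric] by simp
  qed simp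
  \<comment> \<open>Conjugating by the \<open>i\<close>-th power moves half of the distance \<open>m\<close> to the other side: the reversal
      shifts the midpoint by \<open>0\<close> or \<open>1\<close>, according to the parity of \<open>m\<close>.\<close>
  obtain i where "m = i + i \<or> m = i + Suc i" by (metis add_Suc_right mult_2 oddE evenE Suc_eq_plus1)
  then show False
  proof
    assume "m = i + i"
    then have "(p ^^ i) (- gamma_pm n ((p ^^ i) x)) = (p ^^ i) ((p ^^ i) x)"
      using m fold[of i] by (simp add: funpow_add)
    then have "- gamma_pm n ((p ^^ i) x) = (p ^^ i) x" using injpow by (simp add: inj_eq)
    moreover have "- gamma_pm n y \<noteq> y" if "y \<in> plusminus n" for y
      using that gamma_in[of _ n]
      by (elim plusminus_cases[OF n_pos])
        (force simp: gamma_pm_pos[OF n_pos] gamma_pm_neg[OF n_pos])+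
    ultimately show False using in_pm by blast
  next
    assume "m = i + Suc i"
    then have "(p ^^ i) (- gamma_pm n ((p ^^ i) x)) = (p ^^ i) (p ((p ^^ i) x))"
      using m fold[of i] by (simp add: funpow_add funpow_swap1)
    then have "- gamma_pm n ((p ^^ i) x) = \<tau> (gamma_pm n ((p ^^ i) x))"
      using injpow by (simp add: inj_eq p_def)
    then show False using not_negated[OF gamma_pm_in[OF n_pos in_pm[of i]]] by simp
  qed
qed

lemma vertex_label_mirror:
  "x \<in> plusminus n \<Longrightarrow> vertex_label n (- gamma_pm n x) = vertex_label n x"
  using vertex_label_eq_iff[of x "- gamma_pm n x"] mirror_in by simp

lemma label_walk_orbit_mirror:
  assumes "x \<in> plusminus n"
  shows "vertex_label n ` walk_orbit (- gamma_pm n x) = vertex_label n ` walk_orbit x"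
proof -
  have sub: "vertex_label n ` walk_orbit x \<subseteq> vertex_label n ` walk_orbit (- gamma_pm n x)"
    if x: "x \<in> plusminus n" for x
  proof
    fix k assume "k \<in> vertex_label n ` walk_orbit x"
    then obtain y where y: "y \<in> walk_orbit x" "k = vertex_label n y" by blast
    then have "k = vertex_label n (- gamma_pm n y)"
      using vertex_label_mirror walk_orbit_subset[OF x] by auto
    moreover have "- gamma_pm n y \<in> walk_orbit (- gamma_pm n x)"
      using walk_orbit_mirror_cong[OF y(1) x] self_in_walk_orbit by blast
    ultimately show "k \<in> vertex_label n ` walk_orbit (- gamma_pm n x)" by blast
  qed
  have "- gamma_pm n (- gamma_pm n x) = x" using gamma_pm_uminus[OF n_pos assms] by simp
  then show ?thesis using sub[OF assms] sub[OF mirror_in[OF assms]] by auto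
qed

lemma label_walk_orbits_meet:
  assumes "x \<in> plusminus n" "y \<in> plusminus n"
    "k \<in> vertex_label n ` walk_orbit x" "k \<in> vertex_label n ` walk_orbit y"
  shows "walk_orbit y = walk_orbit x \<or> walk_orbit y = walk_orbit (- gamma_pm n x)"
proof -
  obtain z w where zw: "z \<in> walk_orbit x" "w \<in> walk_orbit y" "vertex_label n z = vertex_label n w"
    using assms(3,4) by auto
  then have "w = z \<or> w = - gamma_pm n z"
    using vertex_label_eq_iff walk_orbit_subset assms(1,2) by blast
  then show ?thesis
    using walk_orbit_eq[OF zw(1)] walk_orbit_eq[OF zw(2)] walk_orbit_mirror_cong[OF zw(1) assms(1)]
    by auto
qed

lemma partition_on_vertex_partition: "partition_on {1..int n} (vertex_partition n \<tau>)"
proof (rule partition_onI)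
  show "\<Union> (vertex_partition n \<tau>) = {1..int n}"
  proof
    show "\<Union> (vertex_partition n \<tau>) \<subseteq> {1..int n}"
      unfolding vertex_partition_def cycle_partition_def
      using walk_orbit_subset vertex_label_in by blast
    show "{1..int n} \<subseteq> \<Union> (vertex_partition n \<tau>)"
    proof
      fix k assume "k \<in> {1..int n}"
      then have "- k \<in> plusminus n" "vertex_label n (- k) = k"
        by (auto simp: plusminus_iff vertex_label_def)
      then show "k \<in> \<Union> (vertex_partition n \<tau>)"
        unfolding vertex_partition_def cycle_partition_def using self_in_walk_orbit[of "- k"] by force
    qed
  qed
  show "{} \<notin> vertex_partition n \<tau>"
    unfolding vertex_partition_def cycle_partition_def using self_in_walk_orbit by blast
  fix P Q assume P: "P \<in> vertex_partition n \<tau>" and Q: "Q \<in> vertex_partition n \<tau>" and "P \<noteq> Q"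
  obtain x y where x: "x \<in> plusminus n" "P = vertex_label n ` walk_orbit x"
    and y: "y \<in> plusminus n" "Q = vertex_label n ` walk_orbit y"
    using P Q unfolding vertex_partition_def cycle_partition_def by blast
  then show "disjnt P Q"
    using label_walk_orbits_meet[OF x(1) y(1)] label_walk_orbit_mirror[OF x(1)] \<open>P \<noteq> Q\<close>
    unfolding disjnt_iff by metis
qed

text \<open>Each vertex is turned around once in either sense, by two different cycles.\<close>
lemma card_walk_cycles:
  "card (cycle_partition (plusminus n) (\<tau> \<circ> gamma_pm n)) = 2 * card (vertex_partition n \<tau>)"
proof -
  let ?C = "cycle_partition (plusminus n) (\<tau> \<circ> gamma_pm n)"
  have fib: "card {C \<in> ?C. vertex_label n ` C = B} = 2" if B: "B \<in> vertex_partition n \<tau>" for B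
  proof -
    obtain x where x: "x \<in> plusminus n" "B = vertex_label n ` walk_orbit x"
      using B by (auto simp: vertex_partition_def cycle_partition_def)
    have "{C \<in> ?C. vertex_label n ` C = B} = {walk_orbit x, walk_orbit (- gamma_pm n x)}"
    proof (intro equalityI subsetI)
      fix C assume "C \<in> {C \<in> ?C. vertex_label n ` C = B}"
      then obtain y where y: "y \<in> plusminus n" "C = walk_orbit y"
          "vertex_label n ` walk_orbit y = vertex_label n ` walk_orbit x"
        unfolding cycle_partition_def using x(2) by auto
      then show "C \<in> {walk_orbit x, walk_orbit (- gamma_pm n x)}"
        using label_walk_orbits_meet[OF x(1) y(1), of "vertex_label n y"] self_in_walk_orbit by blast
    next
      fix C assume C: "C \<in> {walk_orbit x, walk_orbit (- gamma_pm n x)}"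
      have "walk_orbit x \<in> ?C" "walk_orbit (- gamma_pm n x) \<in> ?C"
        unfolding cycle_partition_def using x(1) mirror_in[OF x(1)] by blast+
      then show "C \<in> {C \<in> ?C. vertex_label n ` C = B}"
        using C x(2) label_walk_orbit_mirror[OF x(1)] by (elim insertE) simp_all
    qed
    moreover have "walk_orbit x \<noteq> walk_orbit (- gamma_pm n x)"
      using mirror_notin_walk_orbit[OF x(1)] self_in_walk_orbit by blast
    ultimately show ?thesis by simp
  qed
  have "finite ?C" by (simp add: cycle_partition_def)
  then have "card ?C = (\<Sum>B\<in>(\<lambda>C. vertex_label n ` C) ` ?C. card {C \<in> ?C. vertex_label n ` C = B})"
    using sum.image_gen[of ?C "\<lambda>_. 1 :: nat" "\<lambda>C. vertex_label n ` C"] by simp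
  also have "\<dots> = (\<Sum>B\<in>vertex_partition n \<tau>. 2)"
    unfolding vertex_partition_def[symmetric] by (intro sum.cong refl fib)
  finally show ?thesis by simp
qed

text \<open>The two halves of the condition on edges, one for tails and one for heads, are the steps of
  \<open>\<tau>\<gamma>\<delta>\<gamma>\<inverse>\<delta>\<close> at a positive and at a negative element. So \<open>\<pi>\<close> realizes \<open>\<tau>\<close> iff the block of the corner
  label is constant along cycles; in particular the vertices of the glued polygon are the finest
  realization.\<close>
lemma realizes_iff:
  "realizes n \<tau> \<pi> \<longleftrightarrow> partition_on {1..int n} \<pi> \<and>
    (\<forall>x\<in>plusminus n. block_of \<pi> (vertex_label n ((\<tau> \<circ> gamma_pm n) x)) = block_of \<pi> (vertex_label n x))"
proof -
  have pm: "r \<in> plusminus n" if "r \<in> {1..int n}" for r using that by (simp add: plusminus_iff)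
  have ne0: "\<tau> r \<noteq> 0" if "r \<in> {1..int n}" for r using maps[OF pm[OF that]] by (auto simp: plusminus_iff)
  have eq: "(\<tau> r > 0 \<longrightarrow> edge n \<pi> r = prod.swap (edge n \<pi> (\<tau> r))) \<and>
        (\<tau> r < 0 \<longrightarrow> edge n \<pi> r = edge n \<pi> (- \<tau> r)) \<longleftrightarrow>
      block_of \<pi> (vertex_label n (\<tau> r)) = block_of \<pi> r \<and>
      block_of \<pi> (vertex_label n (- \<tau> r)) = block_of \<pi> (gamma n r)" if "r \<in> {1..int n}" for r
    using ne0[OF that] by (auto simp: edge_eq vertex_label_def)
  have "(\<forall>r\<in>{1..int n}. block_of \<pi> (vertex_label n (\<tau> r)) = block_of \<pi> r \<and>
      block_of \<pi> (vertex_label n (- \<tau> r)) = block_of \<pi> (gamma n r)) \<longleftrightarrow>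
    (\<forall>x\<in>plusminus n. block_of \<pi> (vertex_label n ((\<tau> \<circ> gamma_pm n) x)) = block_of \<pi> (vertex_label n x))"
    (is "?L \<longleftrightarrow> ?R")
  proof
    assume L: ?L
    show ?R
    proof
      fix x assume "x \<in> plusminus n"
      with n_pos
      show "block_of \<pi> (vertex_label n ((\<tau> \<circ> gamma_pm n) x)) = block_of \<pi> (vertex_label n x)"
      proof (cases rule: plusminus_cases)
        case 1
        then show ?thesis using bspec[OF L gamma_in[OF 1]]
          by (simp add: gamma_pm_pos[OF n_pos]) (simp add: vertex_label_def)
      next
        case (2 j)
        then have "vertex_label n x = gamma n j" using gamma_in[of j n] by (simp add: vertex_label_def)
        then show ?thesis using bspec[OF L 2(1)] 2
          by (simp add: gamma_pm_neg[OF n_pos] odd[OF pm])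
      qed
    qed
  next
    assume R: ?R
    show ?L
    proof (intro ballI conjI)
      fix r assume r: "r \<in> {1..int n}"
      obtain j where j: "j \<in> {1..int n}" "gamma n j = r" using gamma_surj[OF n_pos r] .
      show "block_of \<pi> (vertex_label n (\<tau> r)) = block_of \<pi> r"
        using bspec[OF R pm[OF j(1)]] j by (simp add: gamma_pm_pos[OF n_pos]) (simp add: vertex_label_def)
      have "- gamma n r \<in> plusminus n" "vertex_label n (- gamma n r) = gamma n r"
        using gamma_in[OF r] by (auto simp: plusminus_iff vertex_label_def)
      then show "block_of \<pi> (vertex_label n (- \<tau> r)) = block_of \<pi> (gamma n r)"
        using bspec[OF R, of "- gamma n r"] r by (simp add: gamma_pm_neg[OF n_pos] odd[OF pm])
    qed
  qed
  then show ?thesis unfolding realizes_def using eq by auto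
qed

lemma realizes_vertex_partition: "realizes n \<tau> (vertex_partition n \<tau>)"
  unfolding realizes_iff
proof (intro conjI partition_on_vertex_partition ballI)
  fix x assume x: "x \<in> plusminus n"
  let ?B = "vertex_label n ` walk_orbit x"
  have B: "?B \<in> vertex_partition n \<tau>"
    using x by (auto simp: vertex_partition_def cycle_partition_def)
  have "block_of (vertex_partition n \<tau>) (vertex_label n y) = ?B" if "y \<in> walk_orbit x" for y
    by (rule block_of_eqI[OF partition_on_vertex_partition B]) (use that in blast)
  from this[OF orbit.base] this[OF self_in_walk_orbit]
  show "block_of (vertex_partition n \<tau>) (vertex_label n ((\<tau> \<circ> gamma_pm n) x)) =
      block_of (vertex_partition n \<tau>) (vertex_label n x)" by simp
qed

text \<open>The vertex partition refines every partition that realizes \<open>\<tau>\<close>.\<close>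
lemma card_le_card_vertex_partition:
  assumes "realizes n \<tau> \<pi>"
  shows "card \<pi> \<le> card (vertex_partition n \<tau>)"
proof -
  have \<pi>: "partition_on {1..int n} \<pi>" using assms by (simp add: realizes_def)
  have const: "block_of \<pi> (vertex_label n y) = block_of \<pi> (vertex_label n x)"
    if "y \<in> walk_orbit x" "x \<in> plusminus n" for x y
    using that
  proof (induction rule: orbit.induct)
    case base
    then show ?case using assms realizes_iff by blast
  next
    case (step y)
    then have "y \<in> plusminus n" using walk_orbit_subset by blast
    then show ?case using step assms realizes_iff by metis
  qed
  have "\<pi> \<subseteq> (\<lambda>B. block_of \<pi> (SOME k. k \<in> B)) ` vertex_partition n \<tau>"
  proof
    fix B assume B: "B \<in> \<pi>"
    then obtain k where k: "k \<in> B" "k \<in> {1..int n}" using partition_onD1[OF \<pi>] partition_onD3[OF \<pi>]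
      by (metis UnionI all_not_in_conv)
    then have pm: "- k \<in> plusminus n" and lab: "vertex_label n (- k) = k"
      by (auto simp: plusminus_iff vertex_label_def)
    let ?D = "vertex_label n ` walk_orbit (- k)"
    have D: "?D \<in> vertex_partition n \<tau>"
      using pm by (auto simp: vertex_partition_def cycle_partition_def)
    have "\<exists>j. j \<in> ?D" using self_in_walk_orbit by blast
    then have "(SOME j. j \<in> ?D) \<in> ?D" by (rule someI_ex)
    then obtain y where "y \<in> walk_orbit (- k)" "(SOME j. j \<in> ?D) = vertex_label n y" by blast
    then have "block_of \<pi> (SOME j. j \<in> ?D) = B"
      using const[OF _ pm, of y] lab block_of_eqI[OF \<pi> B k(1)] by simp
    then show "B \<in> (\<lambda>B. block_of \<pi> (SOME k. k \<in> B)) ` vertex_partition n \<tau>" using D by blast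
  qed
  moreover have "finite (vertex_partition n \<tau>)"
    by (simp add: vertex_partition_def cycle_partition_def)
  ultimately show ?thesis by (meson card_image_le card_mono finite_imageI le_trans)
qed

end


section \<open>The graph of a realization\<close>
definition fibre :: "nat \<Rightarrow> int set set \<Rightarrow> int set set \<Rightarrow> int set" where
  "fibre n \<pi> e = {k \<in> {1..int n}. endpoints n \<pi> k = e}"

lemma edge_partition_eq: "edge_partition n \<pi> = fibre n \<pi> ` merged_edges n \<pi>"
  unfolding edge_partition_def quotient_def merged_edges_def fibre_def by auto

lemma inj_on_fibre: "inj_on (fibre n \<pi>) (merged_edges n \<pi>)"
  unfolding inj_on_def fibre_def merged_edges_def by blast

lemma card_edge_partition: "card (edge_partition n \<pi>) = card (merged_edges n \<pi>)"
  unfolding edge_partition_eq by (rule card_image[OF inj_on_fibre])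

lemma finite_merged_edges [simp]: "finite (merged_edges n \<pi>)"
  by (simp add: merged_edges_def)

lemma finite_fibre [simp]: "finite (fibre n \<pi> e)"
  by (rule finite_subset[of _ "{1..int n}"]) (auto simp: fibre_def)

lemma sum_card_fibres: "(\<Sum>e\<in>merged_edges n \<pi>. card (fibre n \<pi> e)) = n"
  using sum.image_gen[of "{1..int n}" "\<lambda>_. 1 :: nat" "endpoints n \<pi>"]
  by (simp add: merged_edges_def fibre_def)

lemma finite_partition_int: "partition_on {1..int n} \<pi> \<Longrightarrow> finite \<pi>"
  using finite_elements[of "{1..int n}"] by simp

lemma edges_on_merged_edges:
  assumes "partition_on {1..int n} \<pi>"
  shows "edges_on \<pi> (merged_edges n \<pi>)"
  unfolding edges_on_def merged_edges_def endpoints_eq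
  using block_of_in(1)[OF assms] gamma_in by blast

text \<open>The edges, in the order of their labels, form a closed walk through all vertices.\<close>
lemma connected_merged_edges:
  assumes "partition_on {1..int n} \<pi>" "n \<ge> 1"
  shows "ugraph_connected \<pi> (merged_edges n \<pi>)"
proof -
  let ?R = "adj_rel \<pi> (merged_edges n \<pi>)"
  have one: "(1::int) \<in> {1..int n}" using assms(2) by simp
  have reach: "(block_of \<pi> 1, block_of \<pi> k) \<in> ?R\<^sup>*" if "k \<in> {1..int n}" for k
    using that
  proof (induction rule: gamma_induct)
    case (step j)
    have "(block_of \<pi> j, block_of \<pi> (gamma n j)) \<in> ?R"
      using block_of_in(1)[OF assms(1)] gamma_in[OF step.hyps] step.hyps
      by (auto simp: adj_rel_def merged_edges_def endpoints_eq insert_commute)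
    then show ?case using step.IH by (meson rtrancl.rtrancl_into_rtrancl)
  qed simp
  have "\<exists>k\<in>{1..int n}. B = block_of \<pi> k" if B: "B \<in> \<pi>" for B
  proof -
    have "B \<noteq> {}" "B \<subseteq> {1..int n}" using B partition_onD1[OF assms(1)] partition_onD3[OF assms(1)] by auto
    then show ?thesis using block_of_eqI[OF assms(1) B] by blast
  qed
  then have "(block_of \<pi> 1, B) \<in> ?R\<^sup>*" if "B \<in> \<pi>" for B using reach that by blast
  then show ?thesis
    unfolding ugraph_connected_iff using block_of_in(1)[OF assms(1) one]
    by (metis adj_rtrancl_sym empty_iff rtrancl_trans)
qed

locale realization = signed_pairing +
  fixes \<pi> :: "int set set"
  assumes realizes: "realizes n \<tau> \<pi>"
begin

lemma partition: "partition_on {1..int n} \<pi>"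
  using realizes by (simp add: realizes_def)

abbreviation E :: "int set set set" where "E \<equiv> merged_edges n \<pi>"

definition partner :: "int \<Rightarrow> int" where "partner r = \<bar>\<tau> r\<bar>"

lemma partner_facts:
  assumes "r \<in> {1..int n}"
  shows "partner r \<in> {1..int n}" "partner r \<noteq> r" "partner (partner r) = r"
    "\<tau> (partner r) < 0 \<longleftrightarrow> \<tau> r < 0" "\<tau> r \<noteq> 0"
proof -
  have r: "r \<in> plusminus n" using assms by (simp add: plusminus_iff)
  show p: "partner r \<in> {1..int n}" using maps[OF r] by (simp add: plusminus_iff partner_def)
  show "partner r \<noteq> r" using not_fixed[OF r] not_negated[OF r] by (auto simp: partner_def abs_if)
  show "\<tau> r \<noteq> 0" using p by (auto simp: partner_def)
  show "partner (partner r) = r" "\<tau> (partner r) < 0 \<longleftrightarrow> \<tau> r < 0"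
    using involutive[OF r] odd[OF maps[OF r]] assms by (auto simp: partner_def abs_if)
qed

lemma edge_opposite: "r \<in> {1..int n} \<Longrightarrow> \<tau> r > 0 \<Longrightarrow> edge n \<pi> r = prod.swap (edge n \<pi> (partner r))"
  using realizes by (simp add: realizes_def partner_def)

lemma edge_same: "r \<in> {1..int n} \<Longrightarrow> \<tau> r < 0 \<Longrightarrow> edge n \<pi> r = edge n \<pi> (partner r)"
  using realizes by (simp add: realizes_def partner_def)

lemma endpoints_partner: "r \<in> {1..int n} \<Longrightarrow> endpoints n \<pi> (partner r) = endpoints n \<pi> r"
  using edge_opposite[of r] edge_same[of r] partner_facts(5)[of r]
  by (cases "\<tau> r > 0") (auto simp: edge_eq endpoints_eq)

lemma pair_subset_fibre:
  "r \<in> {1..int n} \<Longrightarrow> {r, partner r} \<subseteq> fibre n \<pi> (endpoints n \<pi> r)"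
  using endpoints_partner partner_facts by (simp add: fibre_def)

lemma card_pair: "r \<in> {1..int n} \<Longrightarrow> card {r, partner r} = 2"
  using partner_facts(2)[of r] by simp

lemma fibre_two_pairs:
  assumes "r \<in> {1..int n}" "q \<in> fibre n \<pi> (endpoints n \<pi> r)" "q \<notin> {r, partner r}"
  shows "{r, partner r, q, partner q} \<subseteq> fibre n \<pi> (endpoints n \<pi> r)"
    "card {r, partner r, q, partner q} = 4"
proof -
  have q: "q \<in> {1..int n}" "endpoints n \<pi> q = endpoints n \<pi> r" using assms(2) by (auto simp: fibre_def)
  show "{r, partner r, q, partner q} \<subseteq> fibre n \<pi> (endpoints n \<pi> r)"
    using pair_subset_fibre[OF assms(1)] pair_subset_fibre[OF q(1)] q(2) by simp
  have "partner q \<notin> {r, partner r}" using assms(3) partner_facts(3)[OF q(1)] partner_facts(3)[OF assms(1)] by auto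
  then show "card {r, partner r, q, partner q} = 4"
    using assms(3) partner_facts(2)[OF q(1)] partner_facts(2)[OF assms(1)] by auto
qed

lemma fibre_cases:
  assumes "r \<in> {1..int n}"
  obtains "fibre n \<pi> (endpoints n \<pi> r) = {r, partner r}"
  | "card (fibre n \<pi> (endpoints n \<pi> r)) \<ge> 4"
proof (cases "fibre n \<pi> (endpoints n \<pi> r) = {r, partner r}")
  case False
  then obtain q where "q \<in> fibre n \<pi> (endpoints n \<pi> r)" "q \<notin> {r, partner r}"
    using pair_subset_fibre[OF assms] by blast
  from fibre_two_pairs[OF assms this] show ?thesis
    using that(2) card_mono[OF finite_fibre] by metis
qed (use that(1) in blast)

lemma card_fibre_ge_2: "e \<in> E \<Longrightarrow> card (fibre n \<pi> e) \<ge> 2"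
  using pair_subset_fibre card_pair card_mono[OF finite_fibre] unfolding merged_edges_def
  by (metis imageE)

text \<open>How far the number of merged edges falls short of \<open>n/2\<close> is measured by the fibres that hold
  more than one pair.\<close>
lemma fibre_excess: "2 * card E + (\<Sum>e\<in>E. card (fibre n \<pi> e) - 2) = n"
proof -
  have "(\<Sum>e\<in>E. card (fibre n \<pi> e)) = (\<Sum>e\<in>E. 2 + (card (fibre n \<pi> e) - 2))"
    by (intro sum.cong refl) (metis card_fibre_ge_2 le_add_diff_inverse)
  then show ?thesis using sum_card_fibres[of n \<pi>] unfolding sum.distrib by simp
qed

lemma fibre_eq_pair:
  assumes "r \<in> {1..int n}" "card (fibre n \<pi> (endpoints n \<pi> r)) \<le> 3"
  shows "fibre n \<pi> (endpoints n \<pi> r) = {r, partner r}"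
  using assms(1) by (cases rule: fibre_cases) (use assms(2) in simp_all)

text \<open>The closed walk formed by all edges enters and leaves a set \<open>S\<close> of vertices equally often. A
  positive pair contributes one crossing in each direction or none, so already the edges of negative
  pairs cross in both directions equally often.\<close>
lemma opposite_crossing:
  assumes "r \<in> {1..int n}" "\<tau> r < 0" "block_of \<pi> (gamma n r) \<in> S \<longleftrightarrow> block_of \<pi> r \<notin> S"
  shows "\<exists>q\<in>{1..int n}. \<tau> q < 0 \<and> (block_of \<pi> (gamma n q) \<in> S \<longleftrightarrow> block_of \<pi> r \<in> S) \<and>
    (block_of \<pi> q \<in> S \<longleftrightarrow> block_of \<pi> (gamma n r) \<in> S)"
proof (rule ccontr)
  assume none: "\<not> ?thesis"
  define ind where "ind k = (of_bool (block_of \<pi> k \<in> S) :: int)" for k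
  define net where "net k = ind (gamma n k) - ind k" for k
  let ?P = "{k \<in> {1..int n}. \<tau> k > 0}" and ?N = "{k \<in> {1..int n}. \<tau> k < 0}"
  have "sum ind {1..int n} = sum (ind \<circ> gamma n) {1..int n}"
    by (rule sum.permute[OF gamma_permutes[OF n_pos]])
  then have total: "sum net {1..int n} = 0" by (simp add: net_def sum_subtractf)
  have "sum net ?P = sum (\<lambda>k. - net k) ?P"
  proof (rule sum.reindex_bij_witness[of _ partner partner])
    fix k assume k: "k \<in> ?P"
    then have "edge n \<pi> k = prod.swap (edge n \<pi> (partner k))" using edge_opposite by blast
    then show "- net (partner k) = net k" by (simp add: net_def ind_def edge_eq)
  next
    fix k assume k: "k \<in> ?P"
    then show "partner (partner k) = k" "partner k \<in> ?P" "partner (partner k) = k" "partner k \<in> ?P"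
      using partner_facts[of k] partner_facts(5)[of "partner k"] by auto
  qed
  then have P: "sum net ?P = 0" by (simp add: sum_negf)
  have "{1..int n} = ?P \<union> ?N" using partner_facts(5) by (auto simp: less_le_not_le)
  then have "sum net {1..int n} = sum net ?P + sum net ?N"
    by (metis (no_types, lifting) sum.union_disjoint[of ?P ?N net] finite_Collect_conjI finite_atLeastAtMost_int
        disjoint_iff mem_Collect_eq order_less_asym finite_Un)
  then have N: "sum net ?N = 0" using total P by simp
  have "0 \<le> net k * net r" if "k \<in> ?N" for k
    using none that assms(3) unfolding net_def ind_def by auto
  moreover have "(\<Sum>k\<in>?N. net k * net r) = 0" using N by (simp add: sum_distrib_right[symmetric])
  moreover have "finite ?N" by (rule finite_subset[of _ "{1..int n}"]) auto
  ultimately have "\<forall>k\<in>?N. net k * net r = 0" by (simp only: sum_nonneg_eq_0_iff)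
  then have "net r * net r = 0" using assms by blast
  then show False using assms(3) by (auto simp: net_def ind_def split: if_splits)
qed

lemma ends_in_partition:
  "k \<in> {1..int n} \<Longrightarrow> block_of \<pi> k \<in> \<pi> \<and> block_of \<pi> (gamma n k) \<in> \<pi>"
  using block_of_in(1)[OF partition] gamma_in by simp

lemma connected_E: "ugraph_connected \<pi> E"
  by (rule connected_merged_edges[OF partition n_pos])

lemma finite_\<pi>: "finite \<pi>"
  by (rule finite_partition_int[OF partition])

lemma edges_on_E: "F \<subseteq> E \<Longrightarrow> edges_on \<pi> F"
  using edges_on_merged_edges[OF partition] by (auto simp: edges_on_def)

text \<open>A negative pair crosses a cut twice in the same direction, so some other negative pair crosses
  back. Hence the pair does not form a bridge, even after removal of edges that carry no negative pair.\<close>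
lemma same_pair_not_bridge:
  assumes r: "r \<in> {1..int n}" "\<tau> r < 0" "fibre n \<pi> (endpoints n \<pi> r) = {r, partner r}"
    and X: "\<And>k. k \<in> {1..int n} \<Longrightarrow> endpoints n \<pi> k \<in> X \<Longrightarrow> \<tau> k > 0"
    and con: "ugraph_connected \<pi> (E - X)"
  shows "ugraph_connected \<pi> (E - X - {endpoints n \<pi> r})"
proof -
  let ?u = "block_of \<pi> (gamma n r)" and ?v = "block_of \<pi> r"
  have "(?u, ?v) \<in> (adj_rel \<pi> (E - X - {endpoints n \<pi> r}))\<^sup>*"
  proof (rule ccontr)
    assume "\<not> ?thesis"
    from ex_cut[OF this] obtain S where S: "?u \<in> S" "?v \<notin> S"
      "\<forall>x\<in>\<pi>. \<forall>y\<in>\<pi>. {x, y} \<in> E - X \<longrightarrow> {x, y} \<noteq> endpoints n \<pi> r \<longrightarrow> (x \<in> S \<longleftrightarrow> y \<in> S)"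
      by (elim exE conjE)
    obtain q where q: "q \<in> {1..int n}" "\<tau> q < 0" "block_of \<pi> (gamma n q) \<notin> S" "block_of \<pi> q \<in> S"
      using opposite_crossing[OF r(1,2), of S] S(1,2) by blast
    have "endpoints n \<pi> q \<in> E - X" using q(1,2) X[OF q(1)] by (auto simp: merged_edges_def)
    then have "endpoints n \<pi> q = endpoints n \<pi> r"
      using S(3) q(3,4) ends_in_partition[OF q(1)] unfolding endpoints_eq by blast
    then have "q \<in> {r, partner r}" using r(3) q(1) unfolding fibre_def by blast
    then have "edge n \<pi> q = edge n \<pi> r" using edge_same[OF r(1,2)] by (elim insertE) simp_all
    then show False using q(3) S(1) by (simp add: edge_eq)
  qed
  then show ?thesis using connected_delete_edge[OF con, of ?u ?v] by (simp add: endpoints_eq)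
qed

text \<open>There are at most \<open>n/2\<close> merged edges, so more than \<open>n/2\<close> vertices would make the graph a tree with
  one pair over every edge. But a negative pair does not form a bridge.\<close>
lemma card_le_if_same_pair:
  assumes "r \<in> {1..int n}" "\<tau> r < 0"
  shows "2 * card \<pi> \<le> n"
proof -
  let ?e = "endpoints n \<pi> r"
  have e: "?e \<in> E" using assms(1) by (simp add: merged_edges_def)
  show ?thesis using assms(1)
  proof (cases rule: fibre_cases)
    case 1
    have "ugraph_connected \<pi> (E - {?e})"
      using same_pair_not_bridge[OF assms 1, of "{}"] connected_E by simp
    then have "card \<pi> \<le> card (E - {?e}) + 1"
      using finite_\<pi> edges_on_E by (intro connected_card_le) auto
    then have "card \<pi> \<le> card E" using card_Suc_Diff1[OF finite_merged_edges e] by simp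
    then show ?thesis using fibre_excess by linarith
  next
    case 2
    have "card (fibre n \<pi> ?e) - 2 \<le> (\<Sum>e\<in>E. card (fibre n \<pi> e) - 2)"
      by (rule member_le_sum) (use e in auto)
    then have "2 * card E + 2 \<le> n" using 2 fibre_excess by linarith
    moreover have "card \<pi> \<le> card E + 1"
      using finite_\<pi> edges_on_E connected_E by (intro connected_card_le) auto
    ultimately show ?thesis by linarith
  qed
qed

end


section \<open>From partitions to permutations\<close>
lemma pairing_on_mate:
  assumes "pairing_on A P" "r \<in> A"
  obtains s where "{r, s} \<in> P" "s \<in> A" "s \<noteq> r" "\<And>t. {r, t} \<in> P \<Longrightarrow> t = s"
proof -
  have P: "partition_on A P" "\<And>B. B \<in> P \<Longrightarrow> card B = 2" using assms(1) by (auto simp: pairing_on_def)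
  obtain B where B: "B \<in> P" "r \<in> B" using partition_onD1[OF P(1)] assms(2) by blast
  obtain s where s: "B = {r, s}" "s \<noteq> r" using P(2)[OF B(1)] B(2) by (auto simp: card_2_iff)
  have "t = s" if "{r, t} \<in> P" for t
  proof -
    have "{r, t} \<inter> B \<noteq> {}" using B(2) by blast
    then have "{r, t} = B" using disjointD[OF partition_onD2[OF P(1)] that B(1)] by blast
    then show ?thesis using s by (auto simp: doubleton_eq_iff)
  qed
  then show ?thesis using that[of s] s B(1) partition_onD1[OF P(1)] by blast
qed

lemma same_orientation_sym: "same_orientation n \<pi> r s \<longleftrightarrow> same_orientation n \<pi> s r"
  by (auto simp: same_orientation_def)

lemma assoc_perm_at:
  assumes "pairing_on {1..int n} (edge_pairing n k \<pi>)" "{\<bar>x\<bar>, s} \<in> edge_pairing n k \<pi>" "x \<in> plusminus n"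
  shows "assoc_perm n k \<pi> x = (if same_orientation n \<pi> \<bar>x\<bar> s then - sgn x * s else sgn x * s)"
proof -
  have ax: "\<bar>x\<bar> \<in> {1..int n}" using assms(3) by (simp add: plusminus_iff)
  obtain t where "\<And>u. {\<bar>x\<bar>, u} \<in> edge_pairing n k \<pi> \<Longrightarrow> u = t"
    using pairing_on_mate[OF assms(1) ax] by metis
  then have "(THE s. {\<bar>x\<bar>, s} \<in> edge_pairing n k \<pi>) = s"
    using assms(2) by (intro the_equality) auto
  then show ?thesis using assms(3) by (simp add: assoc_perm_def Let_def)
qed

lemma signed_pairing_assoc_perm:
  assumes "n \<ge> 1" "pairing_on {1..int n} (edge_pairing n k \<pi>)"
  shows "signed_pairing n (assoc_perm n k \<pi>)"
proof
  let ?\<tau> = "assoc_perm n k \<pi>"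
  note at = assoc_perm_at[OF assms(2)]
  show "?\<tau> x = x" if "x \<notin> plusminus n" for x using that by (simp add: assoc_perm_def)
  fix x assume x: "x \<in> plusminus n"
  then have ax: "\<bar>x\<bar> \<in> {1..int n}" by (simp add: plusminus_iff)
  obtain s where s: "{\<bar>x\<bar>, s} \<in> edge_pairing n k \<pi>" "s \<in> {1..int n}" "s \<noteq> \<bar>x\<bar>"
    using pairing_on_mate[OF assms(2) ax] by blast
  have \<tau>x: "?\<tau> x = (if same_orientation n \<pi> \<bar>x\<bar> s then - sgn x * s else sgn x * s)"
    using at[OF s(1) x] .
  have x0: "x < 0 \<or> x > 0" using ax by auto
  have abs: "\<bar>?\<tau> x\<bar> = s" using \<tau>x x0 s(2) by (auto simp: sgn_if)
  show m: "?\<tau> x \<in> plusminus n" using abs s(2) by (simp add: plusminus_iff)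
  show "?\<tau> x \<noteq> x" "?\<tau> x \<noteq> - x" using abs s(3) by auto
  show "?\<tau> (- x) = - ?\<tau> x" using at[of "- x" s] s(1) x \<tau>x by (simp add: sgn_minus)
  have "{\<bar>?\<tau> x\<bar>, \<bar>x\<bar>} \<in> edge_pairing n k \<pi>" using s(1) abs by (simp add: insert_commute)
  from at[OF this m] have "?\<tau> (?\<tau> x) =
      (if same_orientation n \<pi> \<bar>x\<bar> s then - sgn (?\<tau> x) * \<bar>x\<bar> else sgn (?\<tau> x) * \<bar>x\<bar>)"
    using abs same_orientation_sym by simp
  then show "?\<tau> (?\<tau> x) = x" using \<tau>x x0 s(2) by (auto simp: sgn_if split: if_splits)
qed (rule assms(1))

text \<open>Equal endpoint sets leave two orders of the ends; for a loop they agree and count as the same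
  orientation.\<close>
lemma endpoints_eq_imp_orientation:
  assumes "endpoints n \<pi> r = endpoints n \<pi> s"
  shows "same_orientation n \<pi> r s \<or> opposite_orientation n \<pi> r s"
  using assms
  by (auto simp: endpoints_eq edge_eq same_orientation_def opposite_orientation_def doubleton_eq_iff)

lemma realizes_assoc_perm:
  assumes "n \<ge> 1" "partition_on {1..int n} \<pi>" "pairing_on {1..int n} (edge_pairing n k \<pi>)"
    "\<And>r s. {r, s} \<in> edge_pairing n k \<pi> \<Longrightarrow> endpoints n \<pi> r = endpoints n \<pi> s"
  shows "realizes n (assoc_perm n k \<pi>) \<pi>"
proof -
  have "(assoc_perm n k \<pi> r > 0 \<longrightarrow> edge n \<pi> r = prod.swap (edge n \<pi> (assoc_perm n k \<pi> r))) \<and>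
      (assoc_perm n k \<pi> r < 0 \<longrightarrow> edge n \<pi> r = edge n \<pi> (- assoc_perm n k \<pi> r))"
    if r: "r \<in> {1..int n}" for r
  proof -
    have "r \<in> plusminus n" "\<bar>r\<bar> = r" "sgn r = 1" using r by (auto simp: plusminus_iff)
    moreover obtain s where s: "{r, s} \<in> edge_pairing n k \<pi>" "s \<in> {1..int n}"
      using pairing_on_mate[OF assms(3) r] by blast
    ultimately have "assoc_perm n k \<pi> r = (if same_orientation n \<pi> r s then - s else s)"
      using assoc_perm_at[OF assms(3), of r s] by simp
    then show ?thesis
      using endpoints_eq_imp_orientation[OF assms(4)[OF s(1)]] s(2)
      by (auto simp: same_orientation_def opposite_orientation_def)
  qed
  then show ?thesis unfolding realizes_def using assms(2) by blast
qed

text \<open>The genus condition asks for exactly \<open>n/2\<close> vertices of the glued polygon. There are at least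
  as many as \<open>\<pi>\<close> has blocks, because \<open>\<pi>\<close> realizes the permutation, and at most \<open>n/2\<close>, because some pair is
  negative. The count of blocks and the pair of edges with the same orientation are what each of the
  three shapes of the graph has to supply.\<close>
lemma assoc_perm_in_NC2_delta:
  assumes "n \<ge> 1" "partition_on {1..int n} \<pi>" "pairing_on {1..int n} (edge_pairing n k \<pi>)"
    "\<And>r s. {r, s} \<in> edge_pairing n k \<pi> \<Longrightarrow> endpoints n \<pi> r = endpoints n \<pi> s"
    "{r, s} \<in> edge_pairing n k \<pi>" "same_orientation n \<pi> r s" "n \<le> 2 * card \<pi>"
  shows "assoc_perm n k \<pi> \<in> NC2_delta n"
proof -
  let ?\<tau> = "assoc_perm n k \<pi>"
  interpret signed_pairing n ?\<tau> using signed_pairing_assoc_perm[OF assms(1,3)] .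
  interpret realization n ?\<tau> "vertex_partition n ?\<tau>"
    by unfold_locales (rule realizes_vertex_partition)
  have "partition_on {1..int n} (edge_pairing n k \<pi>)" using assms(3) by (simp add: pairing_on_def)
  then have rs: "r \<in> {1..int n}" "s \<in> {1..int n}" using assms(5) by (auto simp: partition_on_def)
  then have "?\<tau> r = - s"
    using assoc_perm_at[OF assms(3), of r s] assms(5,6) by (simp add: plusminus_iff)
  then have neg: "?\<tau> r < 0" using rs by simp
  have "card \<pi> \<le> card (vertex_partition n ?\<tau>)"
    using card_le_card_vertex_partition realizes_assoc_perm[OF assms(1-4)] by simp
  then have "2 * card (vertex_partition n ?\<tau>) = n"
    using card_le_if_same_pair[OF rs(1) neg] assms(7) by linarith
  then show ?thesis
    unfolding NC2_delta_iff[OF assms(1)] using card_walk_cycles signed_pairing_axioms neg rs(1) by auto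
qed

lemma edge_partition_endpoints:
  "B \<in> edge_partition n \<pi> \<Longrightarrow> r \<in> B \<Longrightarrow> s \<in> B \<Longrightarrow> endpoints n \<pi> r = endpoints n \<pi> s"
  by (auto simp: edge_partition_eq fibre_def)

lemma partition_on_edge_partition: "partition_on {1..int n} (edge_partition n \<pi>)"
  unfolding edge_partition_def by (intro partition_on_quotient equivI refl_onI symI transI) auto

lemma card_pairing:
  assumes "pairing_on {1..int n} P"
  shows "2 * card P = n"
proof -
  have P: "partition_on {1..int n} P" "\<forall>B\<in>P. card B = 2" using assms by (auto simp: pairing_on_def)
  have "2 * card P = card (\<Union> P)"
  proof (rule card_partition)
    show "finite (\<Union> P)" unfolding partition_onD1[OF P(1), symmetric] by simp
    show "c1 \<inter> c2 = {}" if "c1 \<in> P" "c2 \<in> P" "c1 \<noteq> c2" for c1 c2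
      using partition_onD2[OF P(1)] that by (auto simp: disjoint_def)
  qed (use P finite_partition_int[OF P(1)] in auto)
  then show ?thesis unfolding partition_onD1[OF P(1), symmetric] by simp
qed

text \<open>The loop is the pair with the same orientation. Without it the graph is acyclic, so with it
  there are at most as many edges as vertices.\<close>
lemma U01_NC2:
  assumes "n \<ge> 1" "\<pi> \<in> U01 n"
  shows "assoc_perm n 1 \<pi> \<in> NC2_delta n"
proof -
  let ?E = "merged_edges n \<pi>"
  obtain v where \<pi>: "partition_on {1..int n} \<pi>" and v: "v \<in> \<pi>" "{v} \<in> ?E"
    "ugraph_tree \<pi> (?E - {{v}})" and pair: "pairing_on {1..int n} (edge_partition n \<pi>)"
    using assms(2) unfolding U01_def by blast
  have ep: "edge_pairing n 1 \<pi> = edge_partition n \<pi>" by (simp add: edge_pairing_def)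
  have pair': "pairing_on {1..int n} (edge_pairing n 1 \<pi>)" unfolding ep by (rule pair)
  have ends: "endpoints n \<pi> a = endpoints n \<pi> b" if "{a, b} \<in> edge_pairing n 1 \<pi>" for a b
    using edge_partition_endpoints[OF that[unfolded ep]] by simp
  have "fibre n \<pi> {v} \<in> edge_partition n \<pi>" using v(2) by (simp add: edge_partition_eq)
  moreover from this have "card (fibre n \<pi> {v}) = 2" using pair by (simp add: pairing_on_def)
  then obtain r s where rs: "fibre n \<pi> {v} = {r, s}" by (auto simp: card_2_iff)
  ultimately have "{r, s} \<in> edge_pairing n 1 \<pi>" unfolding ep by simp
  moreover have "endpoints n \<pi> r = {v}" "endpoints n \<pi> s = {v}" using rs by (auto simp: fibre_def)
  then have "same_orientation n \<pi> r s"
    unfolding same_orientation_def edge_eq endpoints_eq by (metis insertCI singletonD)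
  moreover have "card (?E - {{v}}) < card \<pi>"
    using v edges_on_merged_edges[OF \<pi>] finite_partition_int[OF \<pi>]
    by (intro acyclic_card_less) (auto simp: ugraph_tree_def edges_on_def)
  then have "card ?E \<le> card \<pi>" using card_Suc_Diff1[OF finite_merged_edges v(2)] by simp
  then have "n \<le> 2 * card \<pi>" using card_pairing[OF pair] card_edge_partition[of n \<pi>] by simp
  ultimately show ?thesis
    using assoc_perm_in_NC2_delta[OF assms(1) \<pi> pair' ends] by blast
qed

text \<open>Any edge of the cycle can take the place that the loop has in the previous lemma.\<close>
lemma U1_cyc_NC2:
  assumes "n \<ge> 1" "k \<ge> 3" "\<pi> \<in> U1_cyc n k"
  shows "assoc_perm n k \<pi> \<in> NC2_delta n"
proof -
  let ?E = "merged_edges n \<pi>"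
  obtain C where \<pi>: "partition_on {1..int n} \<pi>" and con: "ugraph_connected \<pi> ?E"
    and pair: "pairing_on {1..int n} (edge_partition n \<pi>)"
    and C: "ugraph_cycles \<pi> ?E = {C}" "card C = k"
    and same: "\<forall>B \<in> edge_partition n \<pi>. (\<forall>r\<in>B. endpoints n \<pi> r \<in> C) \<longrightarrow> all_same n \<pi> B"
    using assms(3) unfolding U1_cyc_def by blast
  have ep: "edge_pairing n k \<pi> = edge_partition n \<pi>" using assms(2) by (simp add: edge_pairing_def)
  have pair': "pairing_on {1..int n} (edge_pairing n k \<pi>)" unfolding ep by (rule pair)
  have ends: "endpoints n \<pi> a = endpoints n \<pi> b" if "{a, b} \<in> edge_pairing n k \<pi>" for a b
    using edge_partition_endpoints[OF that[unfolded ep]] by simp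
  have "C \<noteq> {}" using C(2) assms(2) by auto
  then obtain e where e: "e \<in> C" by blast
  moreover have "C \<in> ugraph_cycles \<pi> ?E" using C(1) by simp
  then have "C \<subseteq> ?E" by (auto simp: ugraph_cycles_def)
  ultimately have eE: "e \<in> ?E" by blast
  then have B: "fibre n \<pi> e \<in> edge_partition n \<pi>" by (simp add: edge_partition_eq)
  then have "card (fibre n \<pi> e) = 2" using pair by (simp add: pairing_on_def)
  then obtain r s where rs: "fibre n \<pi> e = {r, s}" "r \<noteq> s" by (auto simp: card_2_iff)
  have "\<forall>t\<in>fibre n \<pi> e. endpoints n \<pi> t \<in> C" using e by (simp add: fibre_def)
  then have "all_same n \<pi> {r, s}" using same B rs(1) by metis
  then have "same_orientation n \<pi> r s" using rs(2) by (simp add: all_same_def)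
  moreover have "{r, s} \<in> edge_pairing n k \<pi>" using B rs(1) by (simp add: ep)
  moreover have "ugraph_cycles \<pi> (?E - {e}) = {}" unfolding cycles_delete_edge C(1) using e by auto
  then have "card (?E - {e}) < card \<pi>"
    using con edges_on_merged_edges[OF \<pi>] finite_partition_int[OF \<pi>]
    by (intro acyclic_card_less) (auto simp: ugraph_connected_iff edges_on_def)
  then have "card ?E \<le> card \<pi>" using card_Suc_Diff1[OF finite_merged_edges eE] by simp
  then have "n \<le> 2 * card \<pi>" using card_pairing[OF pair] card_edge_partition[of n \<pi>] by simp
  ultimately show ?thesis
    using assoc_perm_in_NC2_delta[OF assms(1) \<pi> pair' ends] by blast
qed

lemma split_edge_partition_eq:
  assumes "B \<in> edge_partition n \<pi>" "card B = 4"
    "\<forall>B' \<in> edge_partition n \<pi> - {B}. card B' = 2"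
    "A \<subseteq> B" "card A = 2" "all_same n \<pi> A" "all_same n \<pi> (B - A)"
    "\<forall>r\<in>A. \<forall>s\<in>B - A. opposite_orientation n \<pi> r s"
  shows "split_edge_partition n \<pi> = edge_partition n \<pi> - {B} \<union> {A, B - A}"
proof -
  have finB: "finite B" using assms(2) by (simp add: card_ge_0_finite)
  then have "card (B - A) = 2" using assms(2,4,5) by (simp add: card_Diff_subset finite_subset)
  then obtain c d where cd: "B - A = {c, d}" "c \<noteq> d" by (auto simp: card_2_iff)
  obtain a b where ab: "A = {a, b}" "a \<noteq> b" using assms(5) by (auto simp: card_2_iff)
  have "B \<in> edge_partition n \<pi> \<and> card B = 4 \<and> (B' \<in> edge_partition n \<pi> \<and> card B' = 4 \<longrightarrow> B' = B)" for B'
    using assms(1-3) by (cases "B' = B") auto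
  then have "split_edge_partition n \<pi> = edge_partition n \<pi> - {B} \<union>
      {{r, s} | r s. r \<in> B \<and> s \<in> B \<and> r \<noteq> s \<and> same_orientation n \<pi> r s}"
    unfolding split_edge_partition_def by blast
  also have "{{r, s} | r s. r \<in> B \<and> s \<in> B \<and> r \<noteq> s \<and> same_orientation n \<pi> r s} = {A, B - A}"
  proof
    show "{A, B - A} \<subseteq> {{r, s} | r s. r \<in> B \<and> s \<in> B \<and> r \<noteq> s \<and> same_orientation n \<pi> r s}"
      using assms(4,6,7) ab cd unfolding all_same_def by blast
    show "{{r, s} | r s. r \<in> B \<and> s \<in> B \<and> r \<noteq> s \<and> same_orientation n \<pi> r s} \<subseteq> {A, B - A}"
    proof
      fix X assume "X \<in> {{r, s} | r s. r \<in> B \<and> s \<in> B \<and> r \<noteq> s \<and> same_orientation n \<pi> r s}"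
      then obtain r s where rs: "X = {r, s}" "r \<in> B" "s \<in> B" "r \<noteq> s" "same_orientation n \<pi> r s" by blast
      have iff: "r \<in> A \<longleftrightarrow> s \<in> A"
        using assms(8) rs(2,3,5) unfolding opposite_orientation_def same_orientation_def
        by (metis DiffI)
      show "X \<in> {A, B - A}"
      proof (cases "r \<in> A")
        case True
        then have "X = A" using iff rs(1,4) unfolding ab(1) by auto
        then show ?thesis by simp
      next
        case False
        then have "r \<in> {c, d}" "s \<in> {c, d}" using iff rs(2,3) unfolding cd(1)[symmetric] by auto
        then have "X = B - A" using rs(1,4) unfolding cd(1) by auto
        then show ?thesis by simp
      qed
    qed
  qed
  finally show ?thesis .
qed

lemma pairing_on_split_edge_partition:
  assumes "B \<in> edge_partition n \<pi>" "card B = 4"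
    "\<forall>B' \<in> edge_partition n \<pi> - {B}. card B' = 2"
    "A \<subseteq> B" "card A = 2" "all_same n \<pi> A" "all_same n \<pi> (B - A)"
    "\<forall>r\<in>A. \<forall>s\<in>B - A. opposite_orientation n \<pi> r s"
  shows "pairing_on {1..int n} (split_edge_partition n \<pi>)"
proof -
  let ?P = "edge_partition n \<pi>"
  note B = assms(1-3) and A = assms(4-8)
  have ep: "split_edge_partition n \<pi> = ?P - {B} \<union> {A, B - A}"
    by (rule split_edge_partition_eq[OF assms])
  have P: "partition_on {1..int n} ?P" by (rule partition_on_edge_partition)
  have cBA: "card (B - A) = 2"
    using A(1,2) B(2) by (metis card_Diff_subset card_ge_0_finite diff_add_inverse
        numeral_Bit0 finite_subset zero_less_numeral)
  show ?thesis
    unfolding pairing_on_def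
  proof (intro conjI ballI)
    show "partition_on {1..int n} (split_edge_partition n \<pi>)"
    proof (rule partition_onI)
      show "\<Union> (split_edge_partition n \<pi>) = {1..int n}"
        unfolding partition_onD1[OF P] ep using B(1) A(1) by blast
      have "A \<noteq> {}" "B - A \<noteq> {}" using A(2) cBA by (metis card.empty zero_neq_numeral)+
      then show "{} \<notin> split_edge_partition n \<pi>" unfolding ep using partition_onD3[OF P] by blast
      fix X Y assume "X \<in> split_edge_partition n \<pi>" "Y \<in> split_edge_partition n \<pi>" "X \<noteq> Y"
      moreover have "disjnt X Y" if "X \<in> ?P" "Y \<in> ?P" "X \<noteq> Y" for X Y
        using partition_onD2[OF P] that by (auto simp: disjoint_def disjnt_def)
      ultimately show "disjnt X Y" unfolding ep using B(1) A(1) unfolding disjnt_def by blast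
    qed
    fix X assume "X \<in> split_edge_partition n \<pi>"
    then show "card X = 2" unfolding ep using B(3) A(2) cBA by auto
  qed
qed

text \<open>The splitting of the block of size 4 makes the pairs outnumber the edges by one, which is the
  excess of the vertices over the edges in a tree.\<close>
lemma U02_NC2:
  assumes "n \<ge> 1" "\<pi> \<in> U02 n"
  shows "assoc_perm n 2 \<pi> \<in> NC2_delta n"
proof -
  let ?E = "merged_edges n \<pi>" and ?P = "edge_partition n \<pi>"
  obtain B A where \<pi>: "partition_on {1..int n} \<pi>" and tree: "ugraph_tree \<pi> ?E"
    and B: "B \<in> ?P" "card B = 4" "\<forall>B' \<in> ?P - {B}. card B' = 2"
    and A: "A \<subseteq> B" "card A = 2" "all_same n \<pi> A" "all_same n \<pi> (B - A)"
      "\<forall>r\<in>A. \<forall>s\<in>B - A. opposite_orientation n \<pi> r s"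
    using assms(2) unfolding U02_def by (elim CollectE conjE bexE exE) (rule that; blast)
  have ep: "edge_pairing n 2 \<pi> = ?P - {B} \<union> {A, B - A}"
    using split_edge_partition_eq[OF B A] by (simp add: edge_pairing_def)
  have pair: "pairing_on {1..int n} (edge_pairing n 2 \<pi>)"
    using pairing_on_split_edge_partition[OF B A] by (simp add: edge_pairing_def)
  have fin: "finite ?P" by (simp add: edge_partition_eq)
  have "card (edge_pairing n 2 \<pi>) \<le> card ?P + 1"
  proof -
    have "card (edge_pairing n 2 \<pi>) \<le> card (?P - {B}) + card {A, B - A}"
      unfolding ep by (rule card_Un_le)
    moreover have "card {A, B - A} \<le> 2" by (simp add: card_insert_if)
    ultimately show ?thesis using card_Suc_Diff1[OF fin B(1)] by linarith
  qed
  moreover have "card ?E < card \<pi>"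
    using tree edges_on_merged_edges[OF \<pi>] finite_partition_int[OF \<pi>]
    by (intro acyclic_card_less) (auto simp: ugraph_tree_def ugraph_connected_iff)
  ultimately have card: "n \<le> 2 * card \<pi>" using card_pairing[OF pair] card_edge_partition[of n \<pi>] by simp
  obtain a b where ab: "A = {a, b}" "a \<noteq> b" using A(2) by (auto simp: card_2_iff)
  then have "same_orientation n \<pi> a b" using A(3) by (simp add: all_same_def)
  moreover have "{a, b} \<in> edge_pairing n 2 \<pi>" unfolding ep using ab by simp
  moreover have "endpoints n \<pi> r = endpoints n \<pi> s" if rs: "{r, s} \<in> edge_pairing n 2 \<pi>" for r s
  proof -
    obtain B' where B': "B' \<in> ?P" "{r, s} \<subseteq> B'"
      using rs B(1) A(1) unfolding ep by (metis DiffD1 Diff_subset UnE empty_iff insertE order_refl)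
    then show ?thesis using edge_partition_endpoints[OF B'(1)] by simp
  qed
  ultimately show ?thesis
    using assms(1) \<pi> pair card by (intro assoc_perm_in_NC2_delta)
qed


section \<open>From permutations to partitions\<close>
context realization
begin

text \<open>A pair is negative iff its edges have the same orientation, once positive loops are excluded.\<close>
lemma eq_assoc_perm:
  assumes "pairing_on {1..int n} (edge_pairing n k \<pi>)"
    "\<And>r. r \<in> {1..int n} \<Longrightarrow> {r, partner r} \<in> edge_pairing n k \<pi>"
    "\<And>r. r \<in> {1..int n} \<Longrightarrow> \<tau> r > 0 \<Longrightarrow> \<not> same_orientation n \<pi> r (partner r)"
  shows "\<tau> = assoc_perm n k \<pi>"
proof
  fix x
  show "\<tau> x = assoc_perm n k \<pi> x"
  proof (cases "x \<in> plusminus n")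
    case False
    then show ?thesis using outside by (simp add: assoc_perm_def)
  next
    case True
    then have r: "\<bar>x\<bar> \<in> {1..int n}" by (simp add: plusminus_iff)
    have "\<tau> x = sgn x * \<tau> \<bar>x\<bar>" using odd[OF True] r by (auto simp: abs_if sgn_if)
    moreover have "same_orientation n \<pi> \<bar>x\<bar> (partner \<bar>x\<bar>) \<longleftrightarrow> \<tau> \<bar>x\<bar> < 0"
      using assms(3)[OF r] edge_same[OF r] partner_facts(5)[OF r] unfolding same_orientation_def
      by (meson linorder_neqE)
    ultimately show ?thesis
      using assoc_perm_at[OF assms(1) assms(2)[OF r] True] partner_facts(5)[OF r]
      by (auto simp: partner_def)
  qed
qed

lemma opposite_if_not_loop:
  assumes "r \<in> {1..int n}" "\<tau> r > 0" "block_of \<pi> (gamma n r) \<noteq> block_of \<pi> r"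
  shows "opposite_orientation n \<pi> r (partner r)" "opposite_orientation n \<pi> (partner r) r"
    "\<not> same_orientation n \<pi> r (partner r)"
  using edge_opposite[OF assms(1,2)] assms(3)
  by (auto simp: opposite_orientation_def same_orientation_def edge_eq)

lemma edge_in_E: "r \<in> {1..int n} \<Longrightarrow> endpoints n \<pi> r \<in> E"
  by (simp add: merged_edges_def)

lemma endpoints_loop: "r \<in> {1..int n} \<Longrightarrow> block_of \<pi> (gamma n r) = block_of \<pi> r \<Longrightarrow>
    endpoints n \<pi> r = {block_of \<pi> r}"
  by (simp add: endpoints_eq)

lemma card_le_if_connected:
  assumes "F \<subseteq> E" "ugraph_connected \<pi> F"
  shows "card \<pi> \<le> card F + 1"
  using assms finite_\<pi> edges_on_E by (intro connected_card_le) (auto intro: finite_subset)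

lemma fibre_in_edge_partition: "r \<in> {1..int n} \<Longrightarrow> fibre n \<pi> (endpoints n \<pi> r) \<in> edge_partition n \<pi>"
  using edge_in_E by (simp add: edge_partition_eq)

lemma edge_partition_blockE:
  assumes "B \<in> edge_partition n \<pi>"
  obtains r where "r \<in> {1..int n}" "r \<in> B" "B = fibre n \<pi> (endpoints n \<pi> r)"
  using assms unfolding edge_partition_eq merged_edges_def by (auto simp: fibre_def)

end

text \<open>The case in which distinct pairs lie over distinct merged edges; the remaining case is one
  double fibre.\<close>
locale simple_realization = realization +
  assumes card_E: "card (merged_edges n \<pi>) = card \<pi>" and card_\<pi>: "2 * card \<pi> = n"
    and ex_same: "\<exists>r\<in>{1..int n}. \<tau> r < 0"
begin

lemma fibre_eq:
  assumes "r \<in> {1..int n}"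
  shows "fibre n \<pi> (endpoints n \<pi> r) = {r, partner r}"
proof (rule fibre_eq_pair[OF assms])
  have "(\<Sum>e\<in>E. card (fibre n \<pi> e) - 2) = 0" using fibre_excess card_E card_\<pi> by simp
  then have "card (fibre n \<pi> (endpoints n \<pi> r)) - 2 = 0" using edge_in_E[OF assms] by simp
  then show "card (fibre n \<pi> (endpoints n \<pi> r)) \<le> 3" by simp
qed

lemma pairing_edge_partition: "pairing_on {1..int n} (edge_partition n \<pi>)"
  unfolding pairing_on_def
proof (intro conjI ballI partition_on_edge_partition)
  fix B assume "B \<in> edge_partition n \<pi>"
  then obtain r where "r \<in> {1..int n}" "B = fibre n \<pi> (endpoints n \<pi> r)" by (rule edge_partition_blockE)
  then show "card B = 2" using fibre_eq card_pair by simp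
qed

lemma pair_in_edge_partition: "r \<in> {1..int n} \<Longrightarrow> {r, partner r} \<in> edge_partition n \<pi>"
  using fibre_in_edge_partition[of r] by (simp add: fibre_eq)

lemma same_sign_if_same_endpoints:
  assumes "r \<in> {1..int n}" "s \<in> {1..int n}" "endpoints n \<pi> s = endpoints n \<pi> r"
  shows "\<tau> s < 0 \<longleftrightarrow> \<tau> r < 0"
proof -
  have "s \<in> {r, partner r}" using fibre_eq[OF assms(1)] assms(2,3) by (auto simp: fibre_def)
  then show ?thesis using partner_facts(4)[OF assms(1)] by auto
qed

text \<open>Connectivity leaves room for the deletion of one edge only. Deviations from the required shape
  are excluded by exhibiting two edges that could be deleted together.\<close>
lemma not_connected_delete_two:
  assumes "e \<in> E" "f \<in> E" "e \<noteq> f"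
  shows "\<not> ugraph_connected \<pi> (E - {e} - {f})"
proof
  assume "ugraph_connected \<pi> (E - {e} - {f})"
  then have "card \<pi> \<le> card (E - {e} - {f}) + 1" by (intro card_le_if_connected) auto
  moreover have "Suc (Suc (card (E - {e} - {f}))) = card E"
    using assms card_Suc_Diff1[of "E - {e}" f] card_Suc_Diff1[of E e] by simp
  ultimately show False using card_E by simp
qed

lemma connected_delete_same:
  assumes "r \<in> {1..int n}" "\<tau> r < 0"
  shows "ugraph_connected \<pi> (E - {endpoints n \<pi> r})"
  using same_pair_not_bridge[OF assms fibre_eq[OF assms(1)], of "{}"] connected_E by simp

lemma acyclic_delete:
  assumes "e \<in> E" "ugraph_connected \<pi> (E - {e})"
  shows "ugraph_cycles \<pi> (E - {e}) = {}"
  using assms finite_\<pi> edges_on_E card_Suc_Diff1[OF finite_merged_edges assms(1)] card_E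
  by (intro connected_acyclicI) auto

text \<open>A loop is dispensable, so no other edge is; hence all other pairs are positive and the only pair
  left to be negative is the loop.\<close>
lemma in_U01:
  assumes loop: "{v} \<in> E"
  shows "\<pi> \<in> U01 n" "\<tau> = assoc_perm n 1 \<pi>"
proof -
  have other: "\<tau> r > 0 \<and> block_of \<pi> (gamma n r) \<noteq> block_of \<pi> r"
    if r: "r \<in> {1..int n}" "endpoints n \<pi> r \<noteq> {v}" for r
  proof (rule ccontr)
    assume "\<not> ?thesis"
    then consider "\<tau> r < 0" | "block_of \<pi> (gamma n r) = block_of \<pi> r"
      using partner_facts(5)[OF r(1)] by linarith
    then have "ugraph_connected \<pi> (E - {endpoints n \<pi> r})"
    proof cases
      case 1
      then show ?thesis by (rule connected_delete_same[OF r(1)])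
    next
      case 2
      then show ?thesis using connected_delete_loop[OF connected_E] endpoints_loop[OF r(1)] by simp
    qed
    then have "ugraph_connected \<pi> (E - {endpoints n \<pi> r} - {{v}})" by (rule connected_delete_loop)
    then show False using not_connected_delete_two[OF edge_in_E[OF r(1)] loop r(2)] by blast
  qed
  obtain r0 where r0: "r0 \<in> {1..int n}" "\<tau> r0 < 0" using ex_same by blast
  then have r0v: "endpoints n \<pi> r0 = {v}" using other[of r0] by fastforce
  then have v: "v \<in> \<pi>" using ends_in_partition[OF r0(1)] by (auto simp: endpoints_eq)
  have con: "ugraph_connected \<pi> (E - {{v}})" by (rule connected_delete_loop[OF connected_E])
  have tree: "ugraph_tree \<pi> (E - {{v}})"
    using con acyclic_delete[OF loop con] by (simp add: ugraph_tree_def)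
  have opp: "all_opposite n \<pi> B" if B: "B \<in> edge_partition n \<pi>" "\<forall>r\<in>B. endpoints n \<pi> r \<noteq> {v}" for B
  proof -
    obtain r where r: "r \<in> {1..int n}" "r \<in> B" "B = fibre n \<pi> (endpoints n \<pi> r)"
      using B(1) by (rule edge_partition_blockE)
    then have "\<tau> r > 0" "block_of \<pi> (gamma n r) \<noteq> block_of \<pi> r" using other B(2) by auto
    from opposite_if_not_loop[OF r(1) this] show ?thesis
      unfolding r(3) fibre_eq[OF r(1)] all_opposite_def by auto
  qed
  show "\<pi> \<in> U01 n"
    unfolding U01_def using partition v loop tree pairing_edge_partition opp by blast
  show "\<tau> = assoc_perm n 1 \<pi>"
  proof (rule eq_assoc_perm)
    show "pairing_on {1..int n} (edge_pairing n 1 \<pi>)"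
      using pairing_edge_partition by (simp add: edge_pairing_def)
    fix r assume r: "r \<in> {1..int n}"
    show "{r, partner r} \<in> edge_pairing n 1 \<pi>"
      using pair_in_edge_partition[OF r] by (simp add: edge_pairing_def)
    assume "\<tau> r > 0"
    moreover from this have "endpoints n \<pi> r \<noteq> {v}"
      using same_sign_if_same_endpoints[OF r0(1) r] r0(2) r0v by auto
    ultimately show "\<not> same_orientation n \<pi> r (partner r)"
      using other[OF r] opposite_if_not_loop(3)[OF r] by blast
  qed
qed

text \<open>Negative pairs lie on the cycle, because the edges off the cycle are bridges. If a pair on the
  cycle were positive, its edge could be deleted, and then a further edge that carries a negative pair.\<close>
lemma in_U1_cyc:
  assumes no_loop: "\<And>v. {v} \<notin> E"
  shows "\<exists>k\<ge>3. \<pi> \<in> U1_cyc n k \<and> \<tau> = assoc_perm n k \<pi>"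
proof -
  have nl: "block_of \<pi> (gamma n r) \<noteq> block_of \<pi> r" if "r \<in> {1..int n}" for r
    using no_loop endpoints_loop[OF that] edge_in_E[OF that] by metis
  obtain C where C: "ugraph_cycles \<pi> E = {C}"
    using unique_cycle[OF finite_\<pi> finite_merged_edges edges_on_E connected_E] card_E by auto
  obtain vs where vs: "C = closed_walk_edges vs" "vs \<noteq> []" "C \<subseteq> E" "card C = length vs"
  proof -
    have "C \<in> ugraph_cycles \<pi> E" using C by simp
    then show ?thesis using that by (auto simp: ugraph_cycles_def)
  qed
  have "length vs \<noteq> 1"
  proof
    assume "length vs = 1"
    then obtain v where "vs = [v]" by (auto simp: length_Suc_conv)
    then have "{v} \<in> C" using vs(1) by (auto simp: closed_walk_edges_def)
    then show False using vs(3) no_loop by blast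
  qed
  moreover have "length vs \<noteq> 2"
  proof
    assume "length vs = 2"
    then obtain a b where "vs = [a, b]" by (metis length_0_conv length_Suc_conv numeral_2_eq_2)
    then have "C \<subseteq> {{a, b}}" using vs(1) by (auto simp: closed_walk_edges_def less_Suc_eq)
    then have "card C \<le> 1" using card_mono[of "{{a, b}}" C] by simp
    then show False using vs(4) \<open>length vs = 2\<close> by simp
  qed
  moreover have "length vs \<noteq> 0" using vs(2) by simp
  ultimately have k3: "card C \<ge> 3" using vs(4) by linarith
  have off: "\<tau> r > 0" if r: "r \<in> {1..int n}" "endpoints n \<pi> r \<notin> C" for r
  proof (rule ccontr)
    assume "\<not> ?thesis"
    then have "\<tau> r < 0" using partner_facts(5)[OF r(1)] by linarith
    then have "ugraph_cycles \<pi> (E - {endpoints n \<pi> r}) = {}"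
      by (intro acyclic_delete edge_in_E connected_delete_same r(1))
    then show False using C r(2) unfolding cycles_delete_edge by auto
  qed
  have on: "\<tau> r < 0" if r: "r \<in> {1..int n}" "endpoints n \<pi> r \<in> C" for r
  proof (rule ccontr)
    assume "\<not> ?thesis"
    then have pos: "\<tau> k > 0" if "k \<in> {1..int n}" "endpoints n \<pi> k \<in> {endpoints n \<pi> r}" for k
      using same_sign_if_same_endpoints[OF r(1), of k] that partner_facts(5)[of k] by force
    obtain r0 where r0: "r0 \<in> {1..int n}" "\<tau> r0 < 0" using ex_same by blast
    have "ugraph_connected \<pi> (E - {endpoints n \<pi> r})"
      using connected_delete_cycle_edge[OF connected_E _ r(2)] C by simp
    from same_pair_not_bridge[OF r0 fibre_eq[OF r0(1)] pos this]
    have "ugraph_connected \<pi> (E - {endpoints n \<pi> r} - {endpoints n \<pi> r0})" by blast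
    moreover have "endpoints n \<pi> r \<noteq> endpoints n \<pi> r0" using pos[of r0] r0 by force
    ultimately show False using not_connected_delete_two edge_in_E r(1) r0(1) by blast
  qed
  have opp: "all_opposite n \<pi> B" if B: "B \<in> edge_partition n \<pi>" "\<forall>r\<in>B. endpoints n \<pi> r \<notin> C" for B
  proof -
    obtain r where r: "r \<in> {1..int n}" "r \<in> B" "B = fibre n \<pi> (endpoints n \<pi> r)"
      using B(1) by (rule edge_partition_blockE)
    from opposite_if_not_loop[OF r(1) off nl] r B(2) show ?thesis
      unfolding r(3) fibre_eq[OF r(1)] all_opposite_def by auto
  qed
  have same: "all_same n \<pi> B" if B: "B \<in> edge_partition n \<pi>" "\<forall>r\<in>B. endpoints n \<pi> r \<in> C" for B
  proof -
    obtain r where r: "r \<in> {1..int n}" "r \<in> B" "B = fibre n \<pi> (endpoints n \<pi> r)"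
      using B(1) by (rule edge_partition_blockE)
    then have "edge n \<pi> r = edge n \<pi> (partner r)" using edge_same on B(2) by blast
    then show ?thesis
      unfolding r(3) fibre_eq[OF r(1)] all_same_def same_orientation_def by auto
  qed
  have ep: "edge_pairing n (card C) \<pi> = edge_partition n \<pi>" using k3 by (simp add: edge_pairing_def)
  have "\<pi> \<in> U1_cyc n (card C)"
    unfolding U1_cyc_def using partition connected_E pairing_edge_partition C opp same by auto
  moreover have "\<tau> = assoc_perm n (card C) \<pi>"
    using pairing_edge_partition pair_in_edge_partition opposite_if_not_loop(3) nl
    by (intro eq_assoc_perm) (simp_all add: ep)
  ultimately show ?thesis using k3 by blast
qed

end

context realization
begin

text \<open>The graph is a tree, so every edge is a bridge and a negative pair must share its edge with
  another pair. There is room for just one such pair, and it crosses the bridge in the opposite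
  direction.\<close>
lemma in_U02:
  assumes card_E: "card E + 1 = card \<pi>" and card_\<pi>: "2 * card \<pi> = n"
    and r0: "r0 \<in> {1..int n}" "\<tau> r0 < 0"
  shows "\<pi> \<in> U02 n" "\<tau> = assoc_perm n 2 \<pi>"
proof -
  define e0 where "e0 = endpoints n \<pi> r0"
  define B where "B = fibre n \<pi> e0"
  define A where "A = {r0, partner r0}"
  have bridge: "\<not> ugraph_connected \<pi> (E - {e})" if "e \<in> E" for e
  proof
    assume "ugraph_connected \<pi> (E - {e})"
    then have "card \<pi> \<le> card (E - {e}) + 1" by (intro card_le_if_connected) auto
    then show False using card_Suc_Diff1[OF finite_merged_edges that] card_E by simp
  qed
  have nl: "block_of \<pi> (gamma n r) \<noteq> block_of \<pi> r" if "r \<in> {1..int n}" for r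
    using bridge[OF edge_in_E[OF that]] endpoints_loop[OF that] connected_delete_loop[OF connected_E] by metis
  have same_fibre: "fibre n \<pi> (endpoints n \<pi> r) \<noteq> {r, partner r}" if "r \<in> {1..int n}" "\<tau> r < 0" for r
    using same_pair_not_bridge[OF that, of "{}"] connected_E bridge[OF edge_in_E[OF that(1)]] by auto
  have e0: "e0 \<in> E" using r0(1) edge_in_E by (simp add: e0_def)
  have excess: "(\<Sum>e\<in>E. card (fibre n \<pi> e) - 2) = 2" using fibre_excess card_E card_\<pi> by linarith
  have B4: "card B \<ge> 4"
    using fibre_cases[OF r0(1)] same_fibre[OF r0] unfolding B_def e0_def by blast
  have split: "(card B - 2) + (\<Sum>e\<in>E - {e0}. card (fibre n \<pi> e) - 2) = 2"
    using excess sum.remove[OF finite_merged_edges e0, of "\<lambda>e. card (fibre n \<pi> e) - 2"]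
    by (simp add: B_def)
  then have cB: "card B = 4" and rest: "(\<Sum>e\<in>E - {e0}. card (fibre n \<pi> e) - 2) = 0" using B4 by linarith+
  have fib: "fibre n \<pi> (endpoints n \<pi> r) = {r, partner r}"
    if r: "r \<in> {1..int n}" "r \<notin> B" for r
  proof (rule fibre_eq_pair[OF r(1)])
    have "endpoints n \<pi> r \<in> E - {e0}" using r edge_in_E by (auto simp: B_def fibre_def)
    then have "card (fibre n \<pi> (endpoints n \<pi> r)) - 2 = 0" using rest by simp
    then show "card (fibre n \<pi> (endpoints n \<pi> r)) \<le> 3" by simp
  qed
  have pos: "\<tau> r > 0" if r: "r \<in> {1..int n}" "r \<notin> B" for r
    using same_fibre[OF r(1)] fib[OF r] partner_facts(5)[OF r(1)] by linarith
  let ?u = "block_of \<pi> (gamma n r0)" and ?v = "block_of \<pi> r0"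
  have e0_eq: "e0 = {?u, ?v}" by (simp add: e0_def endpoints_eq)
  have "(?u, ?v) \<notin> (adj_rel \<pi> (E - {e0}))\<^sup>*"
    using bridge[OF e0] connected_delete_edge[OF connected_E, of ?u ?v] by (auto simp: e0_eq)
  from ex_cut[OF this] obtain S where S: "?u \<in> S" "?v \<notin> S"
    "\<forall>x\<in>\<pi>. \<forall>y\<in>\<pi>. {x, y} \<in> E \<longrightarrow> {x, y} \<noteq> e0 \<longrightarrow> (x \<in> S \<longleftrightarrow> y \<in> S)"
    by (elim exE conjE)
  obtain q where q: "q \<in> {1..int n}" "\<tau> q < 0" "block_of \<pi> (gamma n q) \<notin> S" "block_of \<pi> q \<in> S"
    using opposite_crossing[OF r0, of S] S(1,2) by blast
  have "endpoints n \<pi> q = e0"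
    using S(3) q(3,4) ends_in_partition[OF q(1)] edge_in_E[OF q(1)] unfolding endpoints_eq by blast
  then have qB: "q \<in> B" and swap: "block_of \<pi> (gamma n q) = ?v" "block_of \<pi> q = ?u"
    using q S(1,2) by (auto simp: B_def fibre_def e0_eq endpoints_eq doubleton_eq_iff)
  have edges: "edge n \<pi> s = (?u, ?v)" if "s \<in> A" for s
    using that edge_same[OF r0] by (auto simp: A_def edge_eq)
  have edges': "edge n \<pi> s = (?v, ?u)" if "s \<in> {q, partner q}" for s
    using that edge_same[OF q(1,2)] swap by (auto simp: edge_eq)
  have uv: "?u \<noteq> ?v" using S(1,2) by metis
  have disj: "A \<inter> {q, partner q} = {}"
    using edges edges' uv by (metis Pair_inject disjoint_iff)
  then have sub: "{r0, partner r0, q, partner q} \<subseteq> B" "card {r0, partner r0, q, partner q} = 4"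
    using fibre_two_pairs[OF r0(1), of q] qB by (auto simp: A_def B_def e0_def)
  have B_eq: "B = {r0, partner r0, q, partner q}"
    using card_subset_eq[OF _ sub(1)] sub(2) cB by (simp add: B_def)
  have BA: "B - A = {q, partner q}"
    using disj unfolding B_eq A_def by blast
  have BP: "B \<in> edge_partition n \<pi>" using e0 by (simp add: B_def edge_partition_eq)
  have others: "\<exists>r. r \<in> {1..int n} \<and> r \<notin> B \<and> B' = {r, partner r}"
    if B': "B' \<in> edge_partition n \<pi> - {B}" for B'
  proof -
    have "B' \<in> edge_partition n \<pi>" using B' by blast
    then obtain r where r: "r \<in> {1..int n}" "B' = fibre n \<pi> (endpoints n \<pi> r)"
      by (rule edge_partition_blockE)
    moreover from this have "r \<notin> B" using B' by (auto simp: B_def fibre_def)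
    ultimately show ?thesis using fib by blast
  qed
  have others2: "\<forall>B'\<in>edge_partition n \<pi> - {B}. card B' = 2" using others card_pair by blast
  have others_opp: "\<forall>B'\<in>edge_partition n \<pi> - {B}. all_opposite n \<pi> B'"
  proof
    fix B' assume "B' \<in> edge_partition n \<pi> - {B}"
    then obtain r where r: "r \<in> {1..int n}" "r \<notin> B" "B' = {r, partner r}" using others by blast
    from opposite_if_not_loop[OF r(1) pos[OF r(1,2)] nl[OF r(1)]]
    show "all_opposite n \<pi> B'" unfolding r(3) all_opposite_def by auto
  qed
  have A: "A \<subseteq> B" "card A = 2" "all_same n \<pi> A" "all_same n \<pi> (B - A)"
      "\<forall>r\<in>A. \<forall>s\<in>B - A. opposite_orientation n \<pi> r s"
    using sub(1) card_pair[OF r0(1)] edges edges' uv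
    unfolding BA all_same_def same_orientation_def opposite_orientation_def
    by (auto simp: A_def)
  have tree: "ugraph_tree \<pi> E"
    unfolding ugraph_tree_def
    using connected_E connected_acyclicI[OF finite_\<pi> finite_merged_edges edges_on_E connected_E] card_E
    by simp
  show "\<pi> \<in> U02 n"
    unfolding U02_def using partition tree BP cB others2 others_opp A by blast
  have ep: "edge_pairing n 2 \<pi> = split_edge_partition n \<pi>" by (simp add: edge_pairing_def)
  show "\<tau> = assoc_perm n 2 \<pi>"
  proof (rule eq_assoc_perm)
    show "pairing_on {1..int n} (edge_pairing n 2 \<pi>)"
      unfolding ep by (rule pairing_on_split_edge_partition[OF BP cB others2 A])
    fix r assume r: "r \<in> {1..int n}"
    show "{r, partner r} \<in> edge_pairing n 2 \<pi>"
      unfolding ep split_edge_partition_eq[OF BP cB others2 A] BA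
    proof (cases "r \<in> B")
      case True
      then have "{r, partner r} = A \<or> {r, partner r} = {q, partner q}"
        using partner_facts(3)[OF r0(1)] partner_facts(3)[OF q(1)]
        by (auto simp: B_eq A_def)
      then show "{r, partner r} \<in> edge_partition n \<pi> - {B} \<union> {A, {q, partner q}}" by blast
    next
      case False
      then have "{r, partner r} \<in> edge_partition n \<pi>"
        using fib[OF r] fibre_in_edge_partition[OF r] by simp
      then show "{r, partner r} \<in> edge_partition n \<pi> - {B} \<union> {A, {q, partner q}}"
        using False by blast
    qed
    assume "\<tau> r > 0"
    then show "\<not> same_orientation n \<pi> r (partner r)"
      by (rule opposite_if_not_loop(3)[OF r _ nl[OF r]])
  qed
qed

lemma in_some_U1:
  assumes "2 * card \<pi> = n" "r \<in> {1..int n}" "\<tau> r < 0"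
  shows "\<exists>k\<ge>1. \<pi> \<in> U1 n k \<and> \<tau> = assoc_perm n k \<pi>"
proof -
  have "card \<pi> \<le> card E + 1" by (rule card_le_if_connected[OF order_refl connected_E])
  moreover have "card E \<le> card \<pi>" using fibre_excess assms(1) by linarith
  ultimately consider "card E = card \<pi>" | "card E + 1 = card \<pi>" by linarith
  then show ?thesis
  proof cases
    case 1
    interpret simple_realization n \<tau> \<pi>
      by unfold_locales (use 1 assms in auto)
    show ?thesis
    proof (cases "\<exists>v. {v} \<in> E")
      case True
      then obtain v where "{v} \<in> E" by blast
      from in_U01[OF this] show ?thesis by (intro exI[of _ 1]) (simp add: U1_def)
    next
      case False
      then obtain k where "k \<ge> 3" "\<pi> \<in> U1_cyc n k" "\<tau> = assoc_perm n k \<pi>" using in_U1_cyc by blast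
      then show ?thesis by (intro exI[of _ k]) (auto simp: U1_def)
    qed
  next
    case 2
    from in_U02[OF this assms] show ?thesis by (intro exI[of _ 2]) (simp add: U1_def)
  qed
qed

end

theorem lemma5p2:
  fixes n :: nat
  assumes "n \<ge> 2" and "even n"
  shows "(\<forall>k\<ge>1. \<forall>\<pi> \<in> U1 n k. assoc_perm n k \<pi> \<in> NC2_delta n) \<and>
         (\<forall>\<tau> \<in> NC2_delta n. \<exists>k\<ge>1. \<exists>\<pi> \<in> U1 n k. \<tau> = assoc_perm n k \<pi>)"
proof (intro conjI ballI allI impI)
  have n1: "n \<ge> 1" using assms(1) by simp
  fix k \<pi> assume k: "k \<ge> 1" and \<pi>: "\<pi> \<in> U1 n k"
  from k consider "k = 1" | "k = 2" | "k \<ge> 3" by linarith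
  then show "assoc_perm n k \<pi> \<in> NC2_delta n"
    using \<pi> U01_NC2[OF n1] U02_NC2[OF n1] U1_cyc_NC2[OF n1]
    by cases (simp_all add: U1_def)
next
  have n1: "n \<ge> 1" using assms(1) by simp
  fix \<tau> assume "\<tau> \<in> NC2_delta n"
  then have sp: "signed_pairing n \<tau>"
    and card: "card (cycle_partition (plusminus n) (\<tau> \<circ> gamma_pm n)) = n"
    and ex: "\<exists>r\<in>{1..int n}. \<tau> r < 0"
    by (simp_all add: NC2_delta_iff[OF n1])
  interpret signed_pairing n \<tau> by (rule sp)
  interpret realization n \<tau> "vertex_partition n \<tau>"
    by unfold_locales (rule realizes_vertex_partition)
  show "\<exists>k\<ge>1. \<exists>\<pi>\<in>U1 n k. \<tau> = assoc_perm n k \<pi>"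
    using in_some_U1 ex card card_walk_cycles by metis
qed

end
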